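(* Let $0<\alpha<2$, $a>0$, $b>0$ be constants, let $W\ge 0$ be a random variable such that for some $x_0>0$, $\mathbb{P}(W>x)=a x^{-\alpha}$ for all $x\ge x_0$, and let $G(n,\alpha)$ be the random graph on $\{1,\dots,n\}$ with i.i.d. vertex weights $W_1,\dots,W_n$ distributed as $W$ in which, conditionally on the weights, distinct vertices $i,j$ are joined independently with probability $1-\exp(-bW_iW_j/n)$. Let $\mathcal{K}_{\mathrm{gr}}$, $\mathcal{K}_{\mathrm{qt}}$, $\mathcal{K}_{\mathrm{ft}}$ and $\mathcal{K}_{\mathrm{max}}$ be, respectively, the greedy clique, the quasi top clique, the full top clique and a largest clique of $G(n,\alpha)$, so that $|\mathcal{K}_{\mathrm{max}}|=\omega(G(n,\alpha))$. Then $\mathcal{K}_{\mathrm{gr}}$ and $\mathcal{K}_{\mathrm{qt}}$ both have size $(1+o_{\mathrm p}(1))\,\omega(G(n,\alpha))$; in other words, as $n\to\infty$, $$\frac{|\mathcal{K}_{\mathrm{gr}}|}{|\mathcal{K}_{\mathrm{max}}|}\to 1\quad\text{and}\quad\frac{|\mathcal{K}_{\mathrm{qt}}|}{|\mathcal{K}_{\mathrm{max}}|}\to 1\quad\text{in probability.}$$ On the other hand, $$\frac{|\mathcal{K}_{\mathrm{ft}}|}{|\mathcal{K}_{\mathrm{max}}|}\to 2^{-\alpha/2}\quad\text{in probability.}$$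
   Context: The model: each vertex $i\in\{1,\dots,n\}$ gets a weight $W_i$; the $W_i$ are i.i.d. copies of a nonnegative random variable $W$ with $\mathbb{P}(W>x)=ax^{-\alpha}$ for $x\ge x_0$, where $a,\alpha,x_0>0$ are constants (the distribution below $x_0$ is arbitrary). Conditionally on the weights, each pair $\{i,j\}$ with $1\le i<j\le n$ is joined by an edge with probability $p_{ij}=1-\exp(-\lambda_{ij})$, $\lambda_{ij}=bW_iW_j/n$, independently for all pairs, where $b>0$ is a constant. The resulting simple graph is $G(n,\alpha)$. The constants and the distribution of $W$ are fixed and $n\to\infty$. Write $i\sim j$ if $i$ and $j$ are adjacent; $\omega(G)$ is the number of vertices in a largest clique of $G$; $o_{\mathrm p}(1)$ denotes a random quantity converging to $0$ in probability. The weights are taken to be distinct; otherwise ties are resolved randomly (i.e. vertices of equal weight are put in random order, and the comparisons of weights below refer to the resulting total order). The cliques are: Greedy clique: check vertices in order of decreasing weight and select each vertex that is joined to every vertex already selected, i.e. (recursively) $\mathcal{K}_{\mathrm{gr}}=\{i: i\sim j \text{ for all } j \text{ with } W_j>W_i \text{ and } j\in\mathcal{K}_{\mathrm{gr}}\}$. Quasi top clique: $\mathcal{K}_{\mathrm{qt}}=\{i: i\sim j \text{ for all } j \text{ with } W_j>W_i\}$. Full top clique: $\mathcal{K}_{\mathrm{ft}}=\{i: j\sim k \text{ for all distinct } j,k \text{ with } W_j,W_k\ge W_i\}$. $\mathcal{K}_{\mathrm{max}}$: a largest clique of $G(n,\alpha)$ (chosen at random if there is a tie). *)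

theory Defs
  imports "HOL-Probability.Probability" "HOL-Library.Ramsey" "HOL-Combinatorics.Permutations"
begin

text \<open>
  A simple graph on the vertex set \<open>V\<close> is given by its edge set \<open>E \<subseteq> [V]\<^bsup>2\<^esup>\<close>;
  cliques are those of \<^const>\<open>clique\<close>.
\<close>

definition clique_number :: "'v set \<Rightarrow> 'v set set \<Rightarrow> nat" where
  "clique_number V E = Max (card ` {K. K \<subseteq> V \<and> clique K E})"

definition largest_clique :: "'v set \<Rightarrow> 'v set set \<Rightarrow> 'v set \<Rightarrow> bool" where
  "largest_clique V E K \<longleftrightarrow> K \<subseteq> V \<and> clique K E \<and> card K = clique_number V E"

text \<open>
  The order by decreasing weight: \<open>heavier w \<tau> j i\<close> says that \<open>j\<close> comes strictly before \<open>i\<close>.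
  Vertices of equal weight are ordered by \<open>\<tau>\<close>, which will be a uniformly random permutation.
\<close>

definition heavier :: "('v \<Rightarrow> real) \<Rightarrow> ('v \<Rightarrow> nat) \<Rightarrow> 'v \<Rightarrow> 'v \<Rightarrow> bool" where
  "heavier w \<tau> j i \<longleftrightarrow> w j > w i \<or> (w j = w i \<and> \<tau> j < \<tau> i)"

lemma greedy_clique_unique:
  fixes w :: "'v \<Rightarrow> real" and \<tau> :: "'v \<Rightarrow> nat"
  assumes "finite V"
  shows "\<exists>!K. K = {i \<in> V. \<forall>j\<in>K. heavier w \<tau> j i \<longrightarrow> {i, j} \<in> E}"
proof -
  define R where "R = {(j, i). j \<in> V \<and> i \<in> V \<and> heavier w \<tau> j i}"
  have "trans R" "irrefl R"
    by (auto simp: R_def heavier_def trans_def irrefl_def)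
  then have "acyclic R"
    by (simp add: acyclic_irrefl)
  moreover have "finite R"
    by (rule finite_subset[of _ "V \<times> V"]) (auto simp: R_def assms)
  ultimately have wf: "wf R"
    by (simp add: finite_acyclic_wf)
  define H where "H = (\<lambda>f i. \<forall>j. (j, i) \<in> R \<and> f j \<longrightarrow> {i, j} \<in> E)"
  define K where "K = {i \<in> V. wfrec R H i}"
  have rec: "wfrec R H i \<longleftrightarrow> (\<forall>j. (j, i) \<in> R \<and> wfrec R H j \<longrightarrow> {i, j} \<in> E)" for i
    by (subst wfrec[OF wf]) (auto simp: H_def cut_def)
  have mem: "i \<in> K \<longleftrightarrow> i \<in> V \<and> (\<forall>j\<in>K. heavier w \<tau> j i \<longrightarrow> {i, j} \<in> E)" for i
    using rec[of i] by (auto simp: K_def R_def)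
  have "K = {i \<in> V. \<forall>j\<in>K. heavier w \<tau> j i \<longrightarrow> {i, j} \<in> E}"
    using mem by blast
  moreover have "L = K" if L: "L = {i \<in> V. \<forall>j\<in>L. heavier w \<tau> j i \<longrightarrow> {i, j} \<in> E}" for L
  proof -
    have memL: "i \<in> L \<longleftrightarrow> i \<in> V \<and> (\<forall>j\<in>L. heavier w \<tau> j i \<longrightarrow> {i, j} \<in> E)" for i
      using L by blast
    have "i \<in> L \<longleftrightarrow> i \<in> K" for i
      using wf
    proof (induction i)
      case (less i)
      have "j \<in> L \<longleftrightarrow> j \<in> K" if "i \<in> V" "j \<in> L \<or> j \<in> K" "heavier w \<tau> j i" for j
        using less[of j] that mem[of j] memL[of j] by (auto simp: R_def)
      then show ?case
        using mem[of i] memL[of i] by blast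
    qed
    then show ?thesis
      by blast
  qed
  ultimately show ?thesis
    by blast
qed

definition greedy_clique :: "'v set \<Rightarrow> 'v set set \<Rightarrow> ('v \<Rightarrow> real) \<Rightarrow> ('v \<Rightarrow> nat) \<Rightarrow> 'v set" where
  "greedy_clique V E w \<tau> = (THE K. K = {i \<in> V. \<forall>j\<in>K. heavier w \<tau> j i \<longrightarrow> {i, j} \<in> E})"

definition quasi_top_clique :: "'v set \<Rightarrow> 'v set set \<Rightarrow> ('v \<Rightarrow> real) \<Rightarrow> ('v \<Rightarrow> nat) \<Rightarrow> 'v set" where
  "quasi_top_clique V E w \<tau> = {i \<in> V. \<forall>j\<in>V. heavier w \<tau> j i \<longrightarrow> {i, j} \<in> E}"

definition full_top_clique :: "'v set \<Rightarrow> 'v set set \<Rightarrow> ('v \<Rightarrow> real) \<Rightarrow> ('v \<Rightarrow> nat) \<Rightarrow> 'v set" where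
  "full_top_clique V E w \<tau> =
     {i \<in> V. \<forall>j\<in>V. \<forall>k\<in>V. j \<noteq> k \<and> \<not> heavier w \<tau> i j \<and> \<not> heavier w \<tau> i k \<longrightarrow> {j, k} \<in> E}"

definition edge_prob :: "real \<Rightarrow> nat \<Rightarrow> real \<Rightarrow> real \<Rightarrow> real" where
  "edge_prob b n u v = 1 - exp (- (b * u * v / real n))"

text \<open>
  The random graph on \<open>{1..n}\<close> with i.i.d. weights \<open>W i\<close> of law \<open>D\<close>, random edge set \<open>E\<close>, and
  random tie-breaking permutation \<open>\<tau>\<close>. Assumption \<open>cond_edges\<close> gives the conditional
  probability mass function of \<open>E\<close> given the weights (independent edges), and \<open>tie_break\<close> states
  that \<open>\<tau>\<close> is uniform and independent of the pair (weights, edges).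
\<close>

locale weighted_random_graph = prob_space M for M :: "'a measure" +
  fixes n :: nat and D :: "real measure" and b :: real
    and W :: "nat \<Rightarrow> 'a \<Rightarrow> real" and E :: "'a \<Rightarrow> nat set set" and \<tau> :: "'a \<Rightarrow> nat \<Rightarrow> nat"
  assumes weights_indep: "indep_vars (\<lambda>_. borel) W {1..n}"
    and weights_distr: "\<And>i. i \<in> {1..n} \<Longrightarrow> distr M borel (W i) = D"
    and edges_measurable: "E \<in> M \<rightarrow>\<^sub>M count_space (Pow ([{1..n}]\<^bsup>2\<^esup>))"
    and cond_edges: "\<And>F. F \<subseteq> [{1..n}]\<^bsup>2\<^esup> \<Longrightarrow>
      AE x in M.
        real_cond_exp M
          (vimage_algebra (space M) (\<lambda>y. \<lambda>i\<in>{1..n}. W i y) (PiM {1..n} (\<lambda>_. borel)))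
          (indicator {y \<in> space M. E y = F}) x =
        (\<Prod>(i, j) \<in> {(i, j). 1 \<le> i \<and> i < j \<and> j \<le> n}.
           if {i, j} \<in> F then edge_prob b n (W i x) (W j x)
           else 1 - edge_prob b n (W i x) (W j x))"
    and ties_measurable: "\<tau> \<in> M \<rightarrow>\<^sub>M count_space {p. p permutes {1..n}}"
    and tie_break:
      "distr M
         ((PiM {1..n} (\<lambda>_. borel) \<Otimes>\<^sub>M count_space (Pow ([{1..n}]\<^bsup>2\<^esup>)))
            \<Otimes>\<^sub>M count_space {p. p permutes {1..n}})
         (\<lambda>x. ((\<lambda>i\<in>{1..n}. W i x, E x), \<tau> x)) =
       distr M (PiM {1..n} (\<lambda>_. borel) \<Otimes>\<^sub>M count_space (Pow ([{1..n}]\<^bsup>2\<^esup>)))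
         (\<lambda>x. (\<lambda>i\<in>{1..n}. W i x, E x))
       \<Otimes>\<^sub>M uniform_count_measure {p. p permutes {1..n}}"

text \<open>Convergence in probability to a constant, each \<open>X n\<close> living on its own space \<open>M n\<close>.\<close>

definition tendsto_in_prob ::
    "(nat \<Rightarrow> 'a measure) \<Rightarrow> (nat \<Rightarrow> 'a \<Rightarrow> real) \<Rightarrow> real \<Rightarrow> bool" where
  "tendsto_in_prob M X c \<longleftrightarrow>
     (\<forall>n. X n \<in> borel_measurable (M n)) \<and>
     (\<forall>\<epsilon>>0. (\<lambda>n. measure (M n) {x \<in> space (M n). \<bar>X n x - c\<bar> > \<epsilon>}) \<longlonglongrightarrow> 0)"

end

theory Submission
  imports Defs "HOL-Real_Asymp.Real_Asymp"
begin

text \<open>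
  Measure weights in units of \<open>\<surd>(n log n)\<close>. Let \<open>N(t)\<close> be the number of vertices of weight larger
  than \<open>t \<surd>(n log n)\<close>. By Chebyshev's inequality \<open>N(t)\<close> is concentrated around its mean
  \<open>a t\<^bsup>-\<alpha>\<^esup> \<mu>\<^sub>n\<close>, where \<open>\<mu>\<^sub>n = n powr (1 - \<alpha>/2) (log n) powr (-\<alpha>/2)\<close>; two vertices of weight
  \<open>t \<surd>(n log n)\<close> are nonadjacent with probability \<open>n powr (-b t\<^sup>2)\<close>.

  The quasi top clique is contained in the greedy clique, so both are at most the clique number, and
  it suffices to compare the quasi top clique with the clique number. Let \<open>A\<close> be given by
  \<open>b A\<^sup>2 = 1 - \<alpha>/2\<close>. For \<open>t > A\<close>, the expected number of nonadjacent pairs among the \<open>N(t)\<close> heavy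
  vertices is of order \<open>\<mu>\<^sub>n\<^sup>2 n powr (-b t\<^sup>2) = o(\<mu>\<^sub>n)\<close>. Each heavy vertex that is in no such pair
  belongs to the quasi top clique, which therefore has at least \<open>N(t) - o(\<mu>\<^sub>n)\<close> vertices. For \<open>t < A\<close>,
  two vertices that are not heavy are nonadjacent with probability at least
  \<open>n powr (-b t\<^sup>2)\<close>, and a first moment bound shows that they contain no clique of size \<open>\<epsilon> \<mu>\<^sub>n\<close>; so the
  clique number is at most \<open>N(t) + \<epsilon> \<mu>\<^sub>n\<close>. Letting \<open>t\<close> tend to \<open>A\<close>, all three sizes are
  \<open>(a A\<^bsup>-\<alpha>\<^esup> + o(1)) \<mu>\<^sub>n\<close> in probability.

  The full top clique ends as soon as a single edge is missing, and so the relevant number of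
  nonadjacent pairs is compared with \<open>1\<close> instead of \<open>\<mu>\<^sub>n\<close>. This changes the threshold to
  \<open>b t\<^sup>2 = 2 - \<alpha>\<close>, that is \<open>t = \<surd>2 A\<close>: above it the expected number of nonadjacent pairs tends to \<open>0\<close>;
  below it, the vertices with weights in a short interval are, given the weights, very unlikely to
  form a clique. The size is thus \<open>(a (\<surd>2 A)\<^bsup>-\<alpha>\<^esup> + o(1)) \<mu>\<^sub>n\<close> in probability, and the ratio of the two
  constants is \<open>2 powr (-\<alpha>/2)\<close>.
\<close>

section \<open>Cliques in a graph with ordered vertices\<close>

text \<open>The vertices of weight larger than \<open>t\<close>, and those among them that are not adjacent to all
  the others among them.\<close>

definition heavy :: "'v set \<Rightarrow> ('v \<Rightarrow> real) \<Rightarrow> real \<Rightarrow> 'v set" where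
  "heavy V w t = {i \<in> V. t < w i}"

definition unlinked :: "'v set \<Rightarrow> 'v set set \<Rightarrow> ('v \<Rightarrow> real) \<Rightarrow> real \<Rightarrow> 'v set" where
  "unlinked V E w t = {i \<in> heavy V w t. \<exists>j \<in> heavy V w t. j \<noteq> i \<and> {i, j} \<notin> E}"

lemma finite_heavy [simp]: "finite V \<Longrightarrow> finite (heavy V w t)"
  by (simp add: heavy_def)

lemma card_heavy_eq_middle:
  assumes "finite V" "t \<le> u"
  shows "card (heavy V w t) = card {i \<in> V. t < w i \<and> w i \<le> u} + card (heavy V w u)"
proof -
  have "heavy V w t = {i \<in> V. t < w i \<and> w i \<le> u} \<union> heavy V w u"
    using assms by (auto simp: heavy_def)
  then show ?thesis
    using assms(1) by (simp add: card_Un_disjoint heavy_def disjoint_iff)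
qed

lemma card_clique_le_clique_number:
  assumes "finite V" "K \<subseteq> V" "clique K E"
  shows "card K \<le> clique_number V E"
  unfolding clique_number_def using assms by (intro Max_ge) auto

lemma clique_number_attained:
  assumes "finite V"
  obtains K where "K \<subseteq> V" "clique K E" "card K = clique_number V E"
proof -
  have "clique {} E"
    by (simp add: clique_def)
  then have "card ` {K. K \<subseteq> V \<and> clique K E} \<noteq> {}"
    by blast
  then have "clique_number V E \<in> card ` {K. K \<subseteq> V \<and> clique K E}"
    unfolding clique_number_def using assms by (intro Max_in) auto
  then show ?thesis
    using that by auto
qed

lemma greedy_clique_iff:
  assumes "finite V"
  shows "i \<in> greedy_clique V E w \<tau> \<longleftrightarrow>
    i \<in> V \<and> (\<forall>j\<in>greedy_clique V E w \<tau>. heavier w \<tau> j i \<longrightarrow> {i, j} \<in> E)"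
proof -
  have "greedy_clique V E w \<tau> = {i \<in> V. \<forall>j\<in>greedy_clique V E w \<tau>. heavier w \<tau> j i \<longrightarrow> {i, j} \<in> E}"
    unfolding greedy_clique_def by (rule theI'[OF greedy_clique_unique[OF assms]])
  then show ?thesis
    by blast
qed

lemma greedy_clique_subset:
  assumes "finite V"
  shows "greedy_clique V E w \<tau> \<subseteq> V"
  using greedy_clique_iff[OF assms, of _ E w \<tau>] by auto

lemma clique_greedy_clique:
  assumes "finite V" "inj_on \<tau> V"
  shows "clique (greedy_clique V E w \<tau>) E"
  unfolding clique_def
proof (intro ballI impI)
  fix i j
  assume ij: "i \<in> greedy_clique V E w \<tau>" "j \<in> greedy_clique V E w \<tau>" "i \<noteq> j"
  have i: "i \<in> V" "heavier w \<tau> j i \<Longrightarrow> {i, j} \<in> E" and j: "j \<in> V" "heavier w \<tau> i j \<Longrightarrow> {j, i} \<in> E"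
    using ij greedy_clique_iff[OF assms(1), of i E w \<tau>] greedy_clique_iff[OF assms(1), of j E w \<tau>]
    by blast+
  then have "\<tau> i \<noteq> \<tau> j"
    using assms(2) ij(3) by (meson inj_onD)
  then have "heavier w \<tau> j i \<or> heavier w \<tau> i j"
    by (auto simp: heavier_def)
  then show "{i, j} \<in> E"
    using i(2) j(2) by (auto simp: insert_commute)
qed

lemma quasi_top_clique_subset_greedy_clique:
  assumes "finite V"
  shows "quasi_top_clique V E w \<tau> \<subseteq> greedy_clique V E w \<tau>"
proof
  fix i assume "i \<in> quasi_top_clique V E w \<tau>"
  then have "i \<in> V \<and> (\<forall>j\<in>greedy_clique V E w \<tau>. heavier w \<tau> j i \<longrightarrow> {i, j} \<in> E)"
    using greedy_clique_subset[OF assms, of E w \<tau>] by (auto simp: quasi_top_clique_def)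
  then show "i \<in> greedy_clique V E w \<tau>"
    by (rule greedy_clique_iff[OF assms, THEN iffD2])
qed

lemma card_greedy_clique_le_clique_number:
  assumes "finite V" "inj_on \<tau> V"
  shows "card (greedy_clique V E w \<tau>) \<le> clique_number V E"
  by (intro card_clique_le_clique_number assms greedy_clique_subset clique_greedy_clique)

lemma card_quasi_top_clique_le_card_greedy_clique:
  assumes "finite V"
  shows "card (quasi_top_clique V E w \<tau>) \<le> card (greedy_clique V E w \<tau>)"
  by (intro card_mono quasi_top_clique_subset_greedy_clique
        finite_subset[OF greedy_clique_subset] assms)

text \<open>The vertices heavier than a heavy vertex are themselves heavy.\<close>

lemma card_heavy_le_quasi_top_clique:
  assumes "finite V"
  shows "card (heavy V w t) \<le> card (quasi_top_clique V E w \<tau>) + card (unlinked V E w t)"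
proof -
  have "heavy V w t \<subseteq> quasi_top_clique V E w \<tau> \<union> unlinked V E w t"
  proof
    fix i assume i: "i \<in> heavy V w t"
    show "i \<in> quasi_top_clique V E w \<tau> \<union> unlinked V E w t"
    proof (cases "i \<in> quasi_top_clique V E w \<tau>")
      case False
      then obtain j where j: "j \<in> V" "heavier w \<tau> j i" "{i, j} \<notin> E"
        using i by (auto simp: quasi_top_clique_def heavy_def)
      then have "j \<noteq> i" "j \<in> heavy V w t"
        using i by (auto simp: heavier_def heavy_def)
      then show ?thesis
        using i j by (auto simp: unlinked_def)
    qed simp
  qed
  then have "card (heavy V w t) \<le> card (quasi_top_clique V E w \<tau> \<union> unlinked V E w t)"
    by (rule card_mono[rotated])
       (auto intro: finite_subset[OF _ assms] simp: quasi_top_clique_def unlinked_def heavy_def)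
  also have "\<dots> \<le> card (quasi_top_clique V E w \<tau>) + card (unlinked V E w t)"
    by (rule card_Un_le)
  finally show ?thesis .
qed

lemma card_heavy_le_full_top_clique:
  assumes "finite V" "unlinked V E w t = {}"
  shows "card (heavy V w t) \<le> card (full_top_clique V E w \<tau>)"
proof (rule card_mono)
  show "heavy V w t \<subseteq> full_top_clique V E w \<tau>"
  proof
    fix i assume i: "i \<in> heavy V w t"
    have "{j, k} \<in> E" if "j \<in> V" "k \<in> V" "j \<noteq> k" "\<not> heavier w \<tau> i j" "\<not> heavier w \<tau> i k" for j k
    proof -
      have "j \<in> heavy V w t" "k \<in> heavy V w t"
        using i that by (auto simp: heavier_def heavy_def)
      then show ?thesis
        using assms(2) that(3) by (auto simp: unlinked_def)
    qed
    then show "i \<in> full_top_clique V E w \<tau>"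
      using i by (auto simp: full_top_clique_def heavy_def)
  qed
qed (auto intro: finite_subset[OF _ assms(1)] simp: full_top_clique_def)

text \<open>A missing edge between two vertices heavier than \<open>t\<close> ends the full top clique before the
  weights have come down to \<open>t\<close>.\<close>

lemma card_full_top_clique_le_heavy:
  assumes "finite V" "\<not> clique {i \<in> V. t < w i \<and> w i \<le> u} E"
  shows "card (full_top_clique V E w \<tau>) \<le> card (heavy V w t)"
proof (rule card_mono)
  obtain j k where jk: "j \<in> V" "k \<in> V" "t < w j" "t < w k" "j \<noteq> k" "{j, k} \<notin> E"
    using assms(2) by (auto simp: clique_def)
  show "full_top_clique V E w \<tau> \<subseteq> heavy V w t"
  proof
    fix i assume "i \<in> full_top_clique V E w \<tau>"
    then have "i \<in> V" "heavier w \<tau> i j \<or> heavier w \<tau> i k"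
      using jk by (auto simp: full_top_clique_def)
    then show "i \<in> heavy V w t"
      using jk by (auto simp: heavier_def heavy_def)
  qed
qed (simp add: assms)

text \<open>If no clique of size \<open>k\<close> consists of vertices of weight at most \<open>t\<close> only, then any clique has
  fewer than \<open>k\<close> such vertices.\<close>

lemma clique_number_le_heavy:
  assumes "finite V"
    and "\<And>S. S \<subseteq> V \<Longrightarrow> card S = k \<Longrightarrow> clique S E \<Longrightarrow> \<exists>i\<in>S. t < w i"
  shows "clique_number V E \<le> card (heavy V w t) + k"
proof -
  obtain K where K: "K \<subseteq> V" "clique K E" "card K = clique_number V E"
    using clique_number_attained[OF assms(1)] .
  have fin: "finite K"
    using K(1) assms(1) finite_subset by blast
  have "card (K - heavy V w t) < k"
  proof (rule ccontr)
    assume "\<not> card (K - heavy V w t) < k"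
    then obtain S where S: "S \<subseteq> K - heavy V w t" "card S = k"
      by (meson not_less obtain_subset_with_card_n)
    have "clique S E"
      using K(2) S(1) by (auto simp: clique_def)
    then obtain i where "i \<in> S" "t < w i"
      using assms(2)[of S] S K(1) by blast
    then show False
      using S(1) K(1) by (auto simp: heavy_def)
  qed
  moreover have "card K \<le> card (heavy V w t \<union> (K - heavy V w t))"
    using fin assms(1) by (intro card_mono) auto
  moreover have "\<dots> \<le> card (heavy V w t) + card (K - heavy V w t)"
    by (rule card_Un_le)
  ultimately show ?thesis
    using K(3) by linarith
qed

text \<open>Weights and tie-breaking enter the three cliques only through the order of \<open>V\<close>.\<close>

lemma top_cliques_cong:
  assumes "\<And>i j. i \<in> V \<Longrightarrow> j \<in> V \<Longrightarrow> heavier w \<tau> j i \<longleftrightarrow> heavier w' \<tau>' j i"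
  shows "greedy_clique V E w \<tau> = greedy_clique V E w' \<tau>'"
    and "quasi_top_clique V E w \<tau> = quasi_top_clique V E w' \<tau>'"
    and "full_top_clique V E w \<tau> = full_top_clique V E w' \<tau>'"
proof -
  have "(K = {i \<in> V. \<forall>j\<in>K. heavier w \<tau> j i \<longrightarrow> {i, j} \<in> E}) \<longleftrightarrow>
        (K = {i \<in> V. \<forall>j\<in>K. heavier w' \<tau>' j i \<longrightarrow> {i, j} \<in> E})" for K
  proof (cases "K \<subseteq> V")
    case True
    then have "{i \<in> V. \<forall>j\<in>K. heavier w \<tau> j i \<longrightarrow> {i, j} \<in> E} =
      {i \<in> V. \<forall>j\<in>K. heavier w' \<tau>' j i \<longrightarrow> {i, j} \<in> E}"
      using assms by blast
    then show ?thesis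
      by simp
  qed blast
  then show "greedy_clique V E w \<tau> = greedy_clique V E w' \<tau>'"
    by (simp add: greedy_clique_def)
  show "quasi_top_clique V E w \<tau> = quasi_top_clique V E w' \<tau>'"
    using assms by (auto simp: quasi_top_clique_def)
  show "full_top_clique V E w \<tau> = full_top_clique V E w' \<tau>'"
    using assms by (auto simp: full_top_clique_def)
qed

section \<open>Random edges and weights\<close>

lemma clique_iff_nsets: "clique S F \<longleftrightarrow> [S]\<^bsup>2\<^esup> \<subseteq> F"
  by (auto simp: clique_def nsets_2_eq)

text \<open>The total mass that independent trials with success probabilities \<open>q\<close> give to those outcomes
  in which all trials in \<open>Q\<close> succeed.\<close>

lemma sum_prod_supersets:
  fixes q :: "'e \<Rightarrow> 'b::comm_ring_1"
  assumes "finite P" "Q \<subseteq> P"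
  shows "(\<Sum>F | Q \<subseteq> F \<and> F \<subseteq> P. \<Prod>e\<in>P. if e \<in> F then q e else 1 - q e) = (\<Prod>e\<in>Q. q e)"
proof -
  have fin: "finite (P - Q)" "finite Q"
    using assms finite_subset by auto
  have split: "(\<Prod>e\<in>P. if e \<in> Q \<union> X then q e else 1 - q e) =
      (\<Prod>e\<in>Q. q e) * ((\<Prod>e\<in>X. q e) * (\<Prod>e\<in>P - Q - X. 1 - q e))" if X: "X \<subseteq> P - Q" for X
  proof -
    have "(\<Prod>e\<in>P. if e \<in> Q \<union> X then q e else 1 - q e) =
      (\<Prod>e\<in>P \<inter> (Q \<union> X). q e) * (\<Prod>e\<in>P - (Q \<union> X). 1 - q e)"
      by (subst prod.If_cases[OF assms(1)]) (simp only: Diff_eq Collect_mem_eq)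
    also have "P \<inter> (Q \<union> X) = Q \<union> X"
      using X assms(2) by blast
    also have "P - (Q \<union> X) = P - Q - X"
      by blast
    also have "(\<Prod>e\<in>Q \<union> X. q e) = (\<Prod>e\<in>Q. q e) * (\<Prod>e\<in>X. q e)"
      using X by (intro prod.union_disjoint) (auto intro: finite_subset[OF _ fin(1)] fin)
    finally show ?thesis
      by (simp add: mult.assoc)
  qed
  have "bij_betw (\<lambda>X. Q \<union> X) (Pow (P - Q)) {F. Q \<subseteq> F \<and> F \<subseteq> P}"
    by (rule bij_betwI[where g = "\<lambda>F. F - Q"]) (use assms in auto)
  then have "(\<Sum>F | Q \<subseteq> F \<and> F \<subseteq> P. \<Prod>e\<in>P. if e \<in> F then q e else 1 - q e) =
      (\<Sum>X\<in>Pow (P - Q). \<Prod>e\<in>P. if e \<in> Q \<union> X then q e else 1 - q e)"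
    by (rule sum.reindex_bij_betw[symmetric])
  also have "\<dots> = (\<Sum>X\<in>Pow (P - Q). (\<Prod>e\<in>Q. q e) * ((\<Prod>e\<in>X. q e) * (\<Prod>e\<in>P - Q - X. 1 - q e)))"
    by (rule sum.cong[OF refl]) (rule split, simp)
  also have "\<dots> = (\<Prod>e\<in>Q. q e) * (\<Prod>e\<in>P - Q. q e + (1 - q e))"
    by (simp only: prod_add[OF fin(1)] sum_distrib_left)
  finally show ?thesis
    by simp
qed

lemma edge_prob_bounds:
  assumes "0 \<le> b" "0 \<le> u" "u \<le> t" "0 \<le> v" "v \<le> t"
  shows "0 \<le> edge_prob b n u v" "edge_prob b n u v \<le> 1 - exp (- (b * t\<^sup>2 / real n))"
proof -
  have "0 \<le> b * u * v / real n"
    using assms by simp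
  then show "0 \<le> edge_prob b n u v"
    by (simp add: edge_prob_def)
  have "u * v \<le> t * t"
    using assms by (intro mult_mono) auto
  then have "b * u * v / real n \<le> b * t\<^sup>2 / real n"
    using assms by (intro divide_right_mono) (auto simp: mult.assoc power2_eq_square intro: mult_left_mono)
  then show "edge_prob b n u v \<le> 1 - exp (- (b * t\<^sup>2 / real n))"
    by (simp add: edge_prob_def)
qed

context weighted_random_graph
begin

text \<open>The \<open>\<sigma>\<close>-algebra generated by the weights.\<close>

definition weight_algebra :: "'a measure" where
  "weight_algebra =
     vimage_algebra (space M) (\<lambda>y. \<lambda>i\<in>{1..n}. W i y) (PiM {1..n} (\<lambda>_. borel))"

lemma space_weight_algebra [simp]: "space weight_algebra = space M"
  by (simp add: weight_algebra_def)

lemma weight_measurable: "i \<in> {1..n} \<Longrightarrow> W i \<in> borel_measurable M"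
  using weights_indep by (simp add: indep_vars_def)

lemma weight_measurable_weight_algebra:
  assumes "i \<in> {1..n}"
  shows "W i \<in> borel_measurable weight_algebra"
proof -
  have "(\<lambda>y. \<lambda>i\<in>{1..n}. W i y) \<in> weight_algebra \<rightarrow>\<^sub>M PiM {1..n} (\<lambda>_. borel)"
    unfolding weight_algebra_def by (rule measurable_vimage_algebra1) (auto simp: space_PiM)
  from measurable_compose[OF this measurable_component_singleton[OF assms]]
  show ?thesis
    using assms by simp
qed

lemma subalgebra_weight_algebra: "subalgebra M weight_algebra"
proof -
  have "(\<lambda>y. \<lambda>i\<in>{1..n}. W i y) \<in> M \<rightarrow>\<^sub>M PiM {1..n} (\<lambda>_. borel)"
    by (intro measurable_restrict weight_measurable)
  then show ?thesis
    unfolding subalgebra_def weight_algebra_def by (simp add: measurable_iff_sets)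
qed

lemma weight_algebra_events: "A \<in> sets weight_algebra \<Longrightarrow> A \<in> events"
  using subalgebra_weight_algebra by (auto simp: subalgebra_def)

sublocale weights: sigma_finite_subalgebra M weight_algebra
  by (rule finite_measure_subalgebra_is_sigma_finite)
     (simp add: finite_measure_subalgebra_def finite_measure_subalgebra_axioms_def
        finite_measure_axioms subalgebra_weight_algebra)

lemma edges_event: "{x \<in> space M. P (E x)} \<in> events"
proof -
  have "E -` {F \<in> Pow ([{1..n}]\<^bsup>2\<^esup>). P F} \<inter> space M \<in> events"
    by (rule measurable_sets[OF edges_measurable]) auto
  also have "E -` {F \<in> Pow ([{1..n}]\<^bsup>2\<^esup>). P F} \<inter> space M = {x \<in> space M. P (E x)}"
    using measurable_space[OF edges_measurable] by auto
  finally show ?thesis .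
qed

text \<open>The conditional probability that the edge \<open>e\<close>, with end points \<open>Min e\<close> and \<open>Max e\<close>, is present
  given the weights.\<close>

definition link_prob :: "nat set \<Rightarrow> 'a \<Rightarrow> real" where
  "link_prob e x = edge_prob b n (W (Min e) x) (W (Max e) x)"

lemma cond_edges_link_prob:
  assumes "F \<subseteq> [{1..n}]\<^bsup>2\<^esup>"
  shows "AE x in M. real_cond_exp M weight_algebra (indicator {y \<in> space M. E y = F}) x =
    (\<Prod>e\<in>[{1..n}]\<^bsup>2\<^esup>. if e \<in> F then link_prob e x else 1 - link_prob e x)"
  using cond_edges[OF assms]
proof eventually_elim
  case (elim x)
  define I where "I = {(i, j). 1 \<le> i \<and> i < j \<and> j \<le> n}"
  have "bij_betw (\<lambda>(i, j). {i, j}) I ([{1..n}]\<^bsup>2\<^esup>)"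
    unfolding bij_betw_def
  proof
    show "inj_on (\<lambda>(i, j). {i, j}) I"
      by (auto simp: inj_on_def I_def doubleton_eq_iff)
    show "(\<lambda>(i, j). {i, j}) ` I = [{1..n}]\<^bsup>2\<^esup>"
      unfolding I_def ordered_nsets_2_eq
      by (auto simp: image_def) (rule exI, rule exI, intro conjI, rule refl, auto)
  qed
  from prod.reindex_bij_betw[OF this, symmetric]
  have "(\<Prod>e\<in>[{1..n}]\<^bsup>2\<^esup>. if e \<in> F then link_prob e x else 1 - link_prob e x) =
    (\<Prod>(i, j)\<in>I. if {i, j} \<in> F then link_prob {i, j} x else 1 - link_prob {i, j} x)"
    by (simp add: case_prod_unfold)
  also have "\<dots> = (\<Prod>(i, j)\<in>I. if {i, j} \<in> F then edge_prob b n (W i x) (W j x)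
           else 1 - edge_prob b n (W i x) (W j x))"
    by (rule prod.cong) (auto simp: I_def link_prob_def min_def max_def)
  finally show ?case
    using elim by (simp add: weight_algebra_def I_def)
qed

text \<open>The defining property of the conditional probability of \<open>E = F\<close>, integrated over an event \<open>A\<close>
  that depends on the weights only. For weights of arbitrary sign the product need not be bounded;
  its integrability is inherited from the conditional expectation.\<close>

lemma prob_edges:
  assumes A: "A \<in> sets weight_algebra" and F: "F \<subseteq> [{1..n}]\<^bsup>2\<^esup>"
  defines "p \<equiv> \<lambda>x. \<Prod>e\<in>[{1..n}]\<^bsup>2\<^esup>. if e \<in> F then link_prob e x else 1 - link_prob e x"
  shows "integrable M (\<lambda>x. indicator A x * p x)"
    and "prob {x \<in> A. E x = F} = (\<integral>x. indicator A x * p x \<partial>M)"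
proof -
  define f :: "'a \<Rightarrow> real" where "f = indicator {y \<in> space M. E y = F}"
  have A': "A \<in> events" "A \<subseteq> space M"
    using weight_algebra_events[OF A] sets.sets_into_space by auto
  have [measurable]: "f \<in> borel_measurable M"
    using edges_event[of "\<lambda>G. G = F"] by (simp add: f_def)
  have f: "integrable M (\<lambda>x. indicator A x * f x)"
  proof (rule integrable_const_bound[where B = 1])
    show "(\<lambda>x. indicator A x * f x) \<in> borel_measurable M"
      using A'(1) by measurable
  qed (auto simp: f_def indicator_def)
  have [measurable]: "(indicator A :: 'a \<Rightarrow> real) \<in> borel_measurable weight_algebra"
    using A by simp
  note cond = weights.real_cond_exp_intg[OF f]
  have ae: "AE x in M. indicator A x * real_cond_exp M weight_algebra f x = indicator A x * p x"
    using cond_edges_link_prob[OF F] unfolding f_def p_def by eventually_elim simp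
  have link: "link_prob e \<in> borel_measurable M" if "e \<in> [{1..n}]\<^bsup>2\<^esup>" for e
  proof -
    have "finite e" "e \<noteq> {}" "e \<subseteq> {1..n}"
      using that by (auto simp: nsets_def)
    then have "Min e \<in> {1..n}" "Max e \<in> {1..n}"
      using Min_in Max_in by (meson subsetD)+
    then have [measurable]: "W (Min e) \<in> borel_measurable M" "W (Max e) \<in> borel_measurable M"
      by (auto intro!: weight_measurable)
    show ?thesis
      unfolding link_prob_def edge_prob_def by measurable
  qed
  have p[measurable]: "p \<in> borel_measurable M"
    unfolding p_def using link by (intro borel_measurable_prod) auto
  have [measurable]: "A \<in> events"
    by (rule A')
  show int: "integrable M (\<lambda>x. indicator A x * p x)"
    using cond(1) by (rule integrable_cong_AE_imp) (use ae in \<open>auto elim: eventually_mono\<close>)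
  have "prob {x \<in> A. E x = F} = (\<integral>x. indicator {x \<in> A. E x = F} x \<partial>M)"
    using A'(2) by (auto simp: Int_def intro!: arg_cong[where f = prob])
  also have "\<dots> = (\<integral>x. indicator A x * f x \<partial>M)"
    using A'(2) by (intro Bochner_Integration.integral_cong) (auto simp: f_def indicator_def)
  also have "\<dots> = (\<integral>x. indicator A x * real_cond_exp M weight_algebra f x \<partial>M)"
    using cond(2) by simp
  also have "\<dots> = (\<integral>x. indicator A x * p x \<partial>M)"
    by (rule integral_cong_AE) (use ae in auto)
  finally show "prob {x \<in> A. E x = F} = (\<integral>x. indicator A x * p x \<partial>M)" .
qed

text \<open>Summing over all edge sets that contain \<open>Q\<close>: given the weights, the probability that all
  edges in \<open>Q\<close> are present is a product over \<open>Q\<close>. All events that involve the edges are reduced to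
  this case.\<close>

lemma prob_superset_edges:
  assumes A: "A \<in> sets weight_algebra" and Q: "Q \<subseteq> [{1..n}]\<^bsup>2\<^esup>"
  shows "integrable M (\<lambda>x. indicator A x * (\<Prod>e\<in>Q. link_prob e x))"
    and "prob {x \<in> A. Q \<subseteq> E x} = (\<integral>x. indicator A x * (\<Prod>e\<in>Q. link_prob e x) \<partial>M)"
proof -
  define P where "P = [{1..n}]\<^bsup>2\<^esup>"
  define \<F> where "\<F> = {F. Q \<subseteq> F \<and> F \<subseteq> P}"
  define p where "p = (\<lambda>F x. \<Prod>e\<in>P. if e \<in> F then link_prob e x else 1 - link_prob e x)"
  have finP: "finite P"
    by (simp add: P_def finite_imp_finite_nsets)
  then have fin: "finite \<F>"
    by (rule finite_subset[rotated, OF finite_Pow_iff[THEN iffD2]]) (auto simp: \<F>_def)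
  have A': "A \<in> events" "A \<subseteq> space M"
    using weight_algebra_events[OF A] sets.sets_into_space by auto
  have sum: "(\<Sum>F\<in>\<F>. indicator A x * p F x) = indicator A x * (\<Prod>e\<in>Q. link_prob e x)" for x
    using sum_prod_supersets[OF finP Q[folded P_def], of "\<lambda>e. link_prob e x"]
    by (simp add: p_def \<F>_def sum_distrib_left[symmetric])
  have int: "integrable M (\<lambda>x. indicator A x * p F x)"
    and prob: "prob {x \<in> A. E x = F} = (\<integral>x. indicator A x * p F x \<partial>M)" if "F \<in> \<F>" for F
    using prob_edges[OF A, of F] that by (auto simp: p_def \<F>_def P_def)
  show "integrable M (\<lambda>x. indicator A x * (\<Prod>e\<in>Q. link_prob e x))"
    unfolding sum[symmetric] using int by (rule Bochner_Integration.integrable_sum)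
  have "{x \<in> A. Q \<subseteq> E x} = (\<Union>F\<in>\<F>. {x \<in> A. E x = F})"
    using A'(2) measurable_space[OF edges_measurable] by (auto simp: \<F>_def P_def)
  also have "prob \<dots> = (\<Sum>F\<in>\<F>. prob {x \<in> A. E x = F})"
  proof (rule finite_measure_finite_Union[OF fin])
    have "{x \<in> A. E x = F} = A \<inter> {x \<in> space M. E x = F}" for F
      using A'(2) by auto
    then show "(\<lambda>F. {x \<in> A. E x = F}) ` \<F> \<subseteq> events"
      using A'(1) edges_event[of "\<lambda>G. G = _"] by auto
  qed (auto simp: disjoint_family_on_def)
  also have "\<dots> = (\<integral>x. (\<Sum>F\<in>\<F>. indicator A x * p F x) \<partial>M)"
    using prob int by (subst Bochner_Integration.integral_sum) auto
  finally show "prob {x \<in> A. Q \<subseteq> E x} = (\<integral>x. indicator A x * (\<Prod>e\<in>Q. link_prob e x) \<partial>M)"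
    by (simp add: sum)
qed

lemma superset_edges_event:
  assumes "A \<in> sets weight_algebra"
  shows "{x \<in> A. P (E x)} \<in> events"
proof -
  have "{x \<in> A. P (E x)} = A \<inter> {x \<in> space M. P (E x)}"
    using sets.sets_into_space[OF assms] by auto
  then show ?thesis
    using weight_algebra_events[OF assms] edges_event[of P] by simp
qed

text \<open>A pair of vertices with nonnegative weights at most \<open>t\<close> is nonadjacent with conditional probability at
  least \<open>exp (- b t\<^sup>2 / n)\<close>.\<close>

lemma prob_clique_le:
  assumes "0 \<le> b" and A: "A \<in> sets weight_algebra" and S: "S \<subseteq> {1..n}"
    and ae: "AE x in M. x \<in> A \<longrightarrow> (\<forall>i\<in>S. 0 \<le> W i x \<and> W i x \<le> t)"
  shows "prob {x \<in> A. clique S (E x)} \<le> (1 - exp (- (b * t\<^sup>2 / real n))) ^ (card S choose 2) * prob A"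
proof -
  define r where "r = 1 - exp (- (b * t\<^sup>2 / real n))"
  define Q where "Q = [S]\<^bsup>2\<^esup>"
  have r: "0 \<le> r"
    using assms(1) by (simp add: r_def)
  have Q: "Q \<subseteq> [{1..n}]\<^bsup>2\<^esup>" "card Q = card S choose 2"
    using nsets_mono[OF S] by (auto simp: Q_def)
  have [measurable]: "A \<in> events"
    using A by (rule weight_algebra_events)
  have "prob {x \<in> A. clique S (E x)} = (\<integral>x. indicator A x * (\<Prod>e\<in>Q. link_prob e x) \<partial>M)"
    using prob_superset_edges(2)[OF A Q(1)] by (simp add: Q_def clique_iff_nsets)
  also have "\<dots> \<le> (\<integral>x. indicator A x * r ^ (card S choose 2) \<partial>M)"
  proof (rule integral_mono_AE[OF prob_superset_edges(1)[OF A Q(1)]])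
    show "integrable M (\<lambda>x. indicator A x * r ^ (card S choose 2))"
      by (intro integrable_mult_left) (simp add: emeasure_eq_measure)
    show "AE x in M. indicator A x * (\<Prod>e\<in>Q. link_prob e x) \<le> indicator A x * r ^ (card S choose 2)"
      using ae
    proof eventually_elim
      case (elim x)
      have "(\<Prod>e\<in>Q. link_prob e x) \<le> (\<Prod>e\<in>Q. r)" if "x \<in> A"
      proof (rule prod_mono)
        fix e assume "e \<in> Q"
        then have "finite e" "e \<noteq> {}" "e \<subseteq> S"
          by (auto simp: Q_def nsets_def)
        then have "Min e \<in> S" "Max e \<in> S"
          using Min_in Max_in by blast+
        then show "0 \<le> link_prob e x \<and> link_prob e x \<le> r"
          using edge_prob_bounds[OF assms(1), of "W (Min e) x" t "W (Max e) x" n] elim that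
          by (auto simp: link_prob_def r_def)
      qed
      then show ?case
        by (auto simp: indicator_def Q(2))
    qed
  qed
  also have "\<dots> = r ^ (card S choose 2) * prob A"
    by (simp add: mult.commute)
  finally show ?thesis
    by (simp add: r_def)
qed

lemma finite_weight_event:
  assumes "finite I" "I \<subseteq> {1..n}" "\<And>i. i \<in> I \<Longrightarrow> B i \<in> sets borel"
  shows "{x \<in> space M. \<forall>i\<in>I. W i x \<in> B i} \<in> sets weight_algebra"
proof -
  have "{x \<in> space weight_algebra. W i x \<in> B i} \<in> sets weight_algebra" if "i \<in> I" for i
  proof -
    have "W i -` B i \<inter> space weight_algebra \<in> sets weight_algebra"
      using assms that by (intro measurable_sets[OF weight_measurable_weight_algebra]) auto
    then show ?thesis
      by (simp add: vimage_def Int_def conj_commute)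
  qed
  then have "{x \<in> space weight_algebra. \<forall>i\<in>I. W i x \<in> B i} \<in> sets weight_algebra"
    using assms(1) by (intro sets.sets_Collect_finite_All) auto
  then show ?thesis
    by simp
qed

lemma AE_weight_nonneg:
  assumes "AE u in D. 0 \<le> u" "i \<in> {1..n}"
  shows "AE x in M. 0 \<le> W i x"
proof -
  have "AE u in distr M borel (W i). 0 \<le> u"
    unfolding weights_distr[OF assms(2)] by (rule assms(1))
  then show ?thesis
    by (subst (asm) AE_distr_iff) (use weight_measurable[OF assms(2)] in auto)
qed

text \<open>First moment bound for the cliques of size \<open>k\<close> among the vertices of weight at most \<open>t\<close>.\<close>

lemma prob_light_clique_le:
  fixes t :: real and k :: nat
  assumes "0 \<le> b" and nonneg: "AE u in D. 0 \<le> u"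
  defines "B \<equiv> {x \<in> space M. \<exists>S\<subseteq>{1..n}. card S = k \<and> clique S (E x) \<and> (\<forall>i\<in>S. W i x \<le> t)}"
  shows "B \<in> events"
    and "prob B \<le> real (n choose k) * (1 - exp (- (b * t\<^sup>2 / real n))) ^ (k choose 2)"
proof -
  define A where "A = (\<lambda>S. {x \<in> space M. \<forall>i\<in>S. W i x \<in> {..t}})"
  have A: "A S \<in> sets weight_algebra" if "S \<in> [{1..n}]\<^bsup>k\<^esup>" for S
    unfolding A_def using that by (intro finite_weight_event) (auto simp: nsets_def)
  have B: "B = (\<Union>S\<in>[{1..n}]\<^bsup>k\<^esup>. {x \<in> A S. clique S (E x)})"
    unfolding B_def A_def nsets_def by (auto intro: finite_subset)
  have fin: "finite ([{1..n}]\<^bsup>k\<^esup>)"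
    by (simp add: finite_imp_finite_nsets)
  have ev: "{x \<in> A S. clique S (E x)} \<in> events" if "S \<in> [{1..n}]\<^bsup>k\<^esup>" for S
    using superset_edges_event[OF A[OF that]] .
  then show "B \<in> events"
    unfolding B using fin by (intro sets.finite_UN) auto
  have "prob B \<le> (\<Sum>S\<in>[{1..n}]\<^bsup>k\<^esup>. prob {x \<in> A S. clique S (E x)})"
    unfolding B using fin ev by (intro finite_measure_subadditive_finite) auto
  also have "\<dots> \<le> (\<Sum>S\<in>[{1..n}]\<^bsup>k\<^esup>. (1 - exp (- (b * t\<^sup>2 / real n))) ^ (k choose 2))"
  proof (rule sum_mono)
    fix S assume S: "S \<in> [{1..n}]\<^bsup>k\<^esup>"
    then have S': "S \<subseteq> {1..n}" "card S = k"
      by (auto simp: nsets_def)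
    have "AE x in M. \<forall>i\<in>{1..n}. 0 \<le> W i x"
      using AE_weight_nonneg[OF nonneg] by (subst AE_finite_all) auto
    then have "AE x in M. x \<in> A S \<longrightarrow> (\<forall>i\<in>S. 0 \<le> W i x \<and> W i x \<le> t)"
      by eventually_elim (use S' in \<open>auto simp: A_def\<close>)
    then have "prob {x \<in> A S. clique S (E x)} \<le>
        (1 - exp (- (b * t\<^sup>2 / real n))) ^ (k choose 2) * prob (A S)"
      using prob_clique_le[OF assms(1) A[OF S] S'(1)] S'(2) by simp
    also have "\<dots> \<le> (1 - exp (- (b * t\<^sup>2 / real n))) ^ (k choose 2) * 1"
      using assms(1) by (intro mult_left_mono) auto
    finally show "prob {x \<in> A S. clique S (E x)} \<le> (1 - exp (- (b * t\<^sup>2 / real n))) ^ (k choose 2)"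
      by simp
  qed
  finally show "prob B \<le> real (n choose k) * (1 - exp (- (b * t\<^sup>2 / real n))) ^ (k choose 2)"
    by simp
qed

text \<open>The set \<open>S\<close> of vertices with weight in \<open>(t, u]\<close> is random, but it is a function of the weights.
  Since the events that \<open>S\<close> equals a given set are disjoint, no factor for the choice of \<open>S\<close>
  appears.\<close>

lemma prob_middle_clique_le:
  fixes t u :: real and k :: nat
  assumes "0 \<le> b" "0 \<le> t"
  defines "B \<equiv> {x \<in> space M. k \<le> card {i \<in> {1..n}. t < W i x \<and> W i x \<le> u} \<and>
     clique {i \<in> {1..n}. t < W i x \<and> W i x \<le> u} (E x)}"
  shows "B \<in> events"
    and "prob B \<le> (1 - exp (- (b * u\<^sup>2 / real n))) ^ (k choose 2)"
proof -
  define r where "r = 1 - exp (- (b * u\<^sup>2 / real n))"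
  define A where "A = (\<lambda>S. {x \<in> space M. \<forall>i\<in>{1..n}. W i x \<in> (if i \<in> S then {t<..u} else - {t<..u})})"
  define \<S> where "\<S> = {S. S \<subseteq> {1..n} \<and> k \<le> card S}"
  have r: "0 \<le> r" "r \<le> 1"
    using assms(1) by (auto simp: r_def)
  have A: "A S \<in> sets weight_algebra" for S
    unfolding A_def by (intro finite_weight_event) auto
  have AS: "x \<in> A S \<longleftrightarrow> x \<in> space M \<and> S = {i \<in> {1..n}. t < W i x \<and> W i x \<le> u}"
    if "S \<in> \<S>" for S x
    using that by (auto simp: A_def \<S>_def split: if_splits)
  have fin: "finite \<S>"
    by (rule finite_subset[of _ "Pow {1..n}"]) (auto simp: \<S>_def)
  have B: "B = (\<Union>S\<in>\<S>. {x \<in> A S. clique S (E x)})"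
    using AS by (auto simp: B_def \<S>_def)
  have ev: "{x \<in> A S. clique S (E x)} \<in> events" for S
    by (rule superset_edges_event[OF A])
  then show "B \<in> events"
    unfolding B using fin by (intro sets.finite_UN) auto
  have "prob B \<le> (\<Sum>S\<in>\<S>. prob {x \<in> A S. clique S (E x)})"
    unfolding B using fin ev by (intro finite_measure_subadditive_finite) auto
  also have "\<dots> \<le> (\<Sum>S\<in>\<S>. r ^ (k choose 2) * prob (A S))"
  proof (rule sum_mono)
    fix S assume S: "S \<in> \<S>"
    have "AE x in M. x \<in> A S \<longrightarrow> (\<forall>i\<in>S. 0 \<le> W i x \<and> W i x \<le> u)"
      using AS[OF S] assms(2) by (auto intro: order_trans[OF _ less_imp_le])
    then have "prob {x \<in> A S. clique S (E x)} \<le> r ^ (card S choose 2) * prob (A S)"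
      using S unfolding r_def by (intro prob_clique_le assms A) (auto simp: \<S>_def)
    also have "\<dots> \<le> r ^ (k choose 2) * prob (A S)"
      using S r by (intro mult_right_mono power_decreasing binomial_right_mono) (auto simp: \<S>_def)
    finally show "prob {x \<in> A S. clique S (E x)} \<le> r ^ (k choose 2) * prob (A S)" .
  qed
  also have "\<dots> = r ^ (k choose 2) * prob (\<Union>S\<in>\<S>. A S)"
    unfolding sum_distrib_left[symmetric] using fin AS weight_algebra_events[OF A]
    by (subst finite_measure_finite_Union) (auto simp: disjoint_family_on_def)
  also have "\<dots> \<le> r ^ (k choose 2) * 1"
    using r by (intro mult_left_mono) auto
  finally show "prob B \<le> (1 - exp (- (b * u\<^sup>2 / real n))) ^ (k choose 2)"
    by (simp add: r_def)
qed

lemma prob_weight_greater: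
  assumes "i \<in> {1..n}"
  shows "prob {x \<in> space M. t < W i x} = measure D {t<..}"
proof -
  have "measure D {t<..} = prob (W i -` {t<..} \<inter> space M)"
    unfolding weights_distr[OF assms, symmetric]
    by (intro measure_distr weight_measurable assms) auto
  then show ?thesis
    by (simp add: vimage_def Int_def conj_commute)
qed

lemma prob_two_weights_greater:
  assumes "i \<in> {1..n}" "j \<in> {1..n}" "i \<noteq> j"
  shows "prob {x \<in> space M. t < W i x \<and> t < W j x} = (measure D {t<..})\<^sup>2"
proof -
  have "{x \<in> space M. t < W i x \<and> t < W j x} = (\<Inter>l\<in>{i, j}. W l -` {t<..} \<inter> space M)"
    by auto
  also have "prob \<dots> = (\<Prod>l\<in>{i, j}. prob (W l -` {t<..} \<inter> space M))"
    using assms by (intro indep_varsD[OF weights_indep]) auto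
  also have "\<dots> = (\<Prod>l\<in>{i, j}. measure D {t<..})"
  proof (rule prod.cong[OF refl])
    fix l assume "l \<in> {i, j}"
    then show "prob (W l -` {t<..} \<inter> space M) = measure D {t<..}"
      using prob_weight_greater[of l t] assms by (auto simp: vimage_def Int_def conj_commute)
  qed
  finally show ?thesis
    using assms(3) by (simp add: power2_eq_square)
qed

lemma card_heavy_eq_sum_indicator:
  assumes "x \<in> space M"
  shows "real (card (heavy {1..n} (\<lambda>i. W i x) t)) =
    (\<Sum>i\<in>{1..n}. indicator {x \<in> space M. t < W i x} x)"
  using assms by (simp add: heavy_def indicator_def sum.If_cases Int_def)

lemma heavy_event: "i \<in> {1..n} \<Longrightarrow> {x \<in> space M. t < W i x} \<in> events"
  using weight_measurable by measurable

text \<open>Chebyshev's inequality for the number of heavy vertices, a sum of independent indicators whose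
  variance is at most its mean.\<close>

lemma prob_heavy_deviation_le:
  fixes t d :: real
  assumes "0 < d"
  defines "p \<equiv> measure D {t<..}"
  defines "B \<equiv> {x \<in> space M. d \<le> \<bar>real (card (heavy {1..n} (\<lambda>i. W i x) t)) - real n * p\<bar>}"
  shows "B \<in> events" and "prob B \<le> real n * p / d\<^sup>2"
proof -
  define A where "A = (\<lambda>i. {x \<in> space M. t < W i x})"
  define f :: "'a \<Rightarrow> real" where "f = (\<lambda>x. \<Sum>i\<in>{1..n}. indicator (A i) x)"
  have A [measurable]: "A i \<in> events" if "i \<in> {1..n}" for i
    unfolding A_def using that by (rule heavy_event)
  have f [measurable]: "f \<in> borel_measurable M"
    unfolding f_def using A by (intro borel_measurable_sum) auto
  have B: "B = {x \<in> space M. d \<le> \<bar>f x - real n * p\<bar>}"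
    unfolding B_def f_def A_def
    by (rule Collect_cong) (metis (no_types, lifting) card_heavy_eq_sum_indicator)
  show "B \<in> events"
    unfolding B by measurable
  have intA: "integrable M (indicator (A i) :: 'a \<Rightarrow> real)" if "i \<in> {1..n}" for i
    using A[OF that] by (simp add: emeasure_eq_measure)
  have probA: "prob (A i) = p" if "i \<in> {1..n}" for i
    using prob_weight_greater[OF that] by (simp add: A_def p_def)
  have E: "expectation f = real n * p"
    unfolding f_def using intA by (subst Bochner_Integration.integral_sum) (auto simp: A probA)
  have sq: "(f x)\<^sup>2 = (\<Sum>i\<in>{1..n}. \<Sum>j\<in>{1..n}. indicator (A i \<inter> A j) x)" for x
    by (simp add: f_def power2_eq_square sum_product indicator_inter_arith)
  have intAA: "integrable M (indicator (A i \<inter> A j) :: 'a \<Rightarrow> real)" if "i \<in> {1..n}" "j \<in> {1..n}" for i j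
    using A[OF that(1)] A[OF that(2)] by (simp add: emeasure_eq_measure)
  have probAA: "prob (A i \<inter> A j) = (if i = j then p else p\<^sup>2)" if "i \<in> {1..n}" "j \<in> {1..n}" for i j
  proof (cases "i = j")
    case False
    have "A i \<inter> A j = {x \<in> space M. t < W i x \<and> t < W j x}"
      by (auto simp: A_def)
    then show ?thesis
      using prob_two_weights_greater[OF that False] False by (simp add: p_def)
  qed (use probA[OF that(1)] in simp)
  have int2: "integrable M (\<lambda>x. (f x)\<^sup>2)"
    unfolding sq using intAA by (intro Bochner_Integration.integrable_sum) auto
  have "expectation (\<lambda>x. (f x)\<^sup>2) = (\<Sum>i\<in>{1..n}. \<Sum>j\<in>{1..n}. prob (A i \<inter> A j))"
  proof -
    have "expectation (\<lambda>x. (f x)\<^sup>2) =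
        (\<Sum>i\<in>{1..n}. expectation (\<lambda>x. \<Sum>j\<in>{1..n}. indicator (A i \<inter> A j) x))"
      unfolding sq
      by (intro Bochner_Integration.integral_sum Bochner_Integration.integrable_sum intAA)
    also have "\<dots> = (\<Sum>i\<in>{1..n}. \<Sum>j\<in>{1..n}. expectation (indicator (A i \<inter> A j)))"
      by (intro sum.cong refl Bochner_Integration.integral_sum intAA)
    also have "\<dots> = (\<Sum>i\<in>{1..n}. \<Sum>j\<in>{1..n}. prob (A i \<inter> A j))"
      using A by (intro sum.cong refl) simp
    finally show ?thesis .
  qed
  also have "\<dots> = (\<Sum>i\<in>{1..n}. \<Sum>j\<in>{1..n}. if i = j then p else p\<^sup>2)"
    by (intro sum.cong refl probAA)
  also have "\<dots> \<le> (\<Sum>i\<in>{1..n}. \<Sum>j\<in>{1..n}. (if i = j then p else 0) + p\<^sup>2)"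
    by (intro sum_mono) (auto simp: p_def)
  also have "\<dots> = real n * p + (real n * p)\<^sup>2"
    by (simp add: sum.distrib power2_eq_square algebra_simps)
  finally have "expectation (\<lambda>x. (f x)\<^sup>2) - (expectation f)\<^sup>2 \<le> real n * p"
    using E by simp
  then have var: "variance f \<le> real n * p"
    using variance_eq[OF square_integrable_imp_integrable[OF f int2] int2] by simp
  have "prob B \<le> variance f / d\<^sup>2"
    unfolding B using Chebyshev_inequality[OF f int2 assms(1)] E by simp
  also have "\<dots> \<le> real n * p / d\<^sup>2"
    using var by (rule divide_right_mono) simp
  finally show "prob B \<le> real n * p / d\<^sup>2" .
qed

lemma prob_nonadjacent_heavy_le:
  fixes t :: real
  assumes "0 \<le> b" "0 \<le> t" "i \<in> {1..n}" "j \<in> {1..n}" "i \<noteq> j"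
  defines "B \<equiv> {x \<in> space M. t < W i x \<and> t < W j x \<and> {i, j} \<notin> E x}"
  shows "B \<in> events"
    and "prob B \<le> exp (- (b * t\<^sup>2 / real n)) * (measure D {t<..})\<^sup>2"
proof -
  define A where "A = {x \<in> space M. \<forall>l\<in>{i, j}. W l x \<in> {t<..}}"
  define r where "r = exp (- (b * t\<^sup>2 / real n))"
  have A: "A \<in> sets weight_algebra"
    unfolding A_def using assms by (intro finite_weight_event) auto
  have A' [measurable]: "A \<in> events"
    using A by (rule weight_algebra_events)
  have Q: "{{i, j}} \<subseteq> [{1..n}]\<^bsup>2\<^esup>"
    using assms by simp
  have B: "B = A - {x \<in> A. {{i, j}} \<subseteq> E x}"
    by (auto simp: B_def A_def)
  have ev: "{x \<in> A. {{i, j}} \<subseteq> E x} \<in> events"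
    by (rule superset_edges_event[OF A])
  show "B \<in> events"
    unfolding B using A' ev by blast
  note edge = prob_superset_edges[OF A Q]
  have indA: "integrable M (indicator A :: 'a \<Rightarrow> real)"
    by (simp add: emeasure_eq_measure)
  have le: "(1 - r) * indicator A x \<le> indicator A x * (\<Prod>e\<in>{{i, j}}. link_prob e x)" for x
  proof (cases "x \<in> A")
    case True
    then have w: "t < W i x" "t < W j x"
      by (auto simp: A_def)
    have "t * t \<le> W i x * W j x"
      using w assms(2) by (intro mult_mono) auto
    then have "b * t\<^sup>2 / real n \<le> b * W i x * W j x / real n"
      using assms(1) by (intro divide_right_mono)
        (auto simp: mult.assoc power2_eq_square intro: mult_left_mono)
    then have "1 - r \<le> link_prob {i, j} x"
      by (cases "i \<le> j") (auto simp: link_prob_def edge_prob_def r_def min_def max_def mult_ac)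
    then show ?thesis
      using True by simp
  qed simp
  have "(1 - r) * prob A = (\<integral>x. (1 - r) * indicator A x \<partial>M)"
    by simp
  also have "\<dots> \<le> (\<integral>x. indicator A x * (\<Prod>e\<in>{{i, j}}. link_prob e x) \<partial>M)"
    using indA edge(1) le by (intro integral_mono) auto
  also have "\<dots> = prob {x \<in> A. {{i, j}} \<subseteq> E x}"
    using edge(2) by simp
  finally have "prob B \<le> r * prob A"
    unfolding B using finite_measure_Diff[OF A' ev] by (auto simp: algebra_simps)
  also have "prob A = (measure D {t<..})\<^sup>2"
    using prob_two_weights_greater[OF assms(3-5)] by (simp add: A_def)
  finally show "prob B \<le> exp (- (b * t\<^sup>2 / real n)) * (measure D {t<..})\<^sup>2"
    by (simp add: r_def)
qed

text \<open>Markov's inequality, applied to the number of ordered pairs of nonadjacent heavy vertices.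
  The bound is given for a larger event \<open>A\<close>, which is measurable.\<close>

lemma prob_unlinked_ge_le:
  fixes t c :: real
  assumes "0 \<le> b" "0 \<le> t" "0 < c"
  defines "B \<equiv> {x \<in> space M. c \<le> real (card (unlinked {1..n} (E x) (\<lambda>i. W i x) t))}"
  defines "m \<equiv> real n * measure D {t<..}"
  shows "\<exists>A\<in>events. B \<subseteq> A \<and> prob A \<le> m\<^sup>2 * exp (- (b * t\<^sup>2 / real n)) / c"
proof -
  define r where "r = exp (- (b * t\<^sup>2 / real n)) * (measure D {t<..})\<^sup>2"
  define J where "J = {(i, j). i \<in> {1..n} \<and> j \<in> {1..n} \<and> i \<noteq> j}"
  define C where "C = (\<lambda>(i, j). {x \<in> space M. t < W i x \<and> t < W j x \<and> {i, j} \<notin> E x})"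
  define f :: "'a \<Rightarrow> real" where "f = (\<lambda>x. \<Sum>e\<in>J. indicator (C e) x)"
  have J: "J \<subseteq> {1..n} \<times> {1..n}"
    by (auto simp: J_def)
  then have finJ: "finite J"
    by (rule finite_subset) simp
  have C: "C e \<in> events" "prob (C e) \<le> r" if "e \<in> J" for e
    using that prob_nonadjacent_heavy_le[OF assms(1,2)] by (auto simp: J_def C_def r_def)
  have int: "integrable M (indicator (C e) :: 'a \<Rightarrow> real)" if "e \<in> J" for e
    using C(1)[OF that] by (simp add: emeasure_eq_measure)
  have intf: "integrable M f"
    unfolding f_def using int by (rule Bochner_Integration.integrable_sum)
  have "real (card (unlinked {1..n} (E x) (\<lambda>i. W i x) t)) \<le> f x" if "x \<in> space M" for x
  proof -
    define L where "L = {e \<in> J. x \<in> C e}"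
    have finL: "finite L"
      using finJ by (simp add: L_def)
    have "unlinked {1..n} (E x) (\<lambda>i. W i x) t \<subseteq> fst ` L"
      using that by (force simp: unlinked_def heavy_def L_def J_def C_def)
    then have "card (unlinked {1..n} (E x) (\<lambda>i. W i x) t) \<le> card L"
      using finL by (meson card_image_le card_mono finite_imageI order_trans)
    also have "real (card L) = f x"
      using finJ by (simp add: f_def L_def indicator_def sum.If_cases Int_def)
    finally show ?thesis
      by simp
  qed
  then have "B \<subseteq> {x \<in> space M. c \<le> f x}"
    by (auto simp: B_def intro: order_trans)
  moreover have "{x \<in> space M. c \<le> f x} \<in> events"
    using borel_measurable_integrable[OF intf] by measurable
  moreover have "prob {x \<in> space M. c \<le> f x} \<le> m\<^sup>2 * exp (- (b * t\<^sup>2 / real n)) / c"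
  proof -
    have "prob {x \<in> space M. c \<le> f x} \<le> expectation f / c"
      using intf assms(3) by (intro integral_Markov_inequality_measure[where A = "{}"])
        (auto simp: f_def intro!: sum_nonneg)
    also have "expectation f = (\<Sum>e\<in>J. prob (C e))"
      unfolding f_def using int C(1) by (subst Bochner_Integration.integral_sum) auto
    also have "\<dots> \<le> real (card J) * r"
      using C(2) by (rule sum_bounded_above)
    also have "\<dots> \<le> (real n)\<^sup>2 * r"
      using card_mono[OF _ J] by (intro mult_right_mono)
        (auto simp: r_def power2_eq_square simp flip: of_nat_mult)
    finally show ?thesis
      using assms(3) by (simp add: r_def m_def power_mult_distrib divide_right_mono mult_ac)
  qed
  ultimately show ?thesis
    by blast
qed

text \<open>Every function of the order of the vertices and the edge set is a random variable, since these
  take only finitely many values.\<close>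

lemma measurable_order_edges:
  fixes X :: "'a \<Rightarrow> real"
  assumes X: "\<And>x y. x \<in> space M \<Longrightarrow> y \<in> space M \<Longrightarrow> E x = E y \<Longrightarrow>
    (\<And>i j. i \<in> {1..n} \<Longrightarrow> j \<in> {1..n} \<Longrightarrow>
      heavier (\<lambda>i. W i x) (\<tau> x) j i \<longleftrightarrow> heavier (\<lambda>i. W i y) (\<tau> y) j i) \<Longrightarrow> X x = X y"
  shows "X \<in> borel_measurable M"
proof -
  define H where "H = (\<lambda>x. {(j, i) \<in> {1..n} \<times> {1..n}. heavier (\<lambda>i. W i x) (\<tau> x) j i})"
  define g where "g = (\<lambda>h F. X (SOME x. x \<in> space M \<and> H x = h \<and> E x = F))"
  have g: "g (H x) (E x) = X x" if "x \<in> space M" for x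
  proof -
    define y where "y = (SOME y. y \<in> space M \<and> H y = H x \<and> E y = E x)"
    have y: "y \<in> space M \<and> H y = H x \<and> E y = E x"
      unfolding y_def by (rule someI[of _ x]) (simp add: that)
    have "X y = X x"
    proof (rule X)
      fix i j assume "i \<in> {1..n}" "j \<in> {1..n}"
      then have "heavier (\<lambda>i. W i z) (\<tau> z) j i \<longleftrightarrow> (j, i) \<in> H z" for z
        by (simp add: H_def)
      then show "heavier (\<lambda>i. W i y) (\<tau> y) j i \<longleftrightarrow> heavier (\<lambda>i. W i x) (\<tau> x) j i"
        using y by simp
    qed (use y that in auto)
    then show ?thesis
      by (simp add: g_def y_def)
  qed
  have ties: "{x \<in> space M. P (\<tau> x)} \<in> events" for P
  proof -
    have "\<tau> -` {p \<in> {p. p permutes {1..n}}. P p} \<inter> space M \<in> events"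
      by (rule measurable_sets[OF ties_measurable]) auto
    also have "\<tau> -` {p \<in> {p. p permutes {1..n}}. P p} \<inter> space M = {x \<in> space M. P (\<tau> x)}"
      using measurable_space[OF ties_measurable] by auto
    finally show ?thesis .
  qed
  have h: "{x \<in> space M. heavier (\<lambda>i. W i x) (\<tau> x) j i} \<in> events" if "(j, i) \<in> {1..n} \<times> {1..n}" for i j
  proof -
    have [measurable]: "W i \<in> borel_measurable M" "W j \<in> borel_measurable M"
      using that by (auto intro: weight_measurable)
    have "{x \<in> space M. heavier (\<lambda>i. W i x) (\<tau> x) j i} = {x \<in> space M. W i x < W j x} \<union>
        ({x \<in> space M. W j x = W i x} \<inter> {x \<in> space M. \<tau> x j < \<tau> x i})"
      by (auto simp: heavier_def)
    also have "\<dots> \<in> events"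
      by (intro sets.Un sets.Int ties) measurable
    finally show ?thesis .
  qed
  have level: "{x \<in> space M. H x = h \<and> E x = F} \<in> events" for h F
  proof (cases "h \<subseteq> {1..n} \<times> {1..n}")
    case True
    have "{x \<in> space M. H x = h \<and> E x = F} =
      {x \<in> space M. \<forall>e\<in>{1..n} \<times> {1..n}. e \<in> h \<longleftrightarrow> heavier (\<lambda>i. W i x) (\<tau> x) (fst e) (snd e)} \<inter>
      {x \<in> space M. E x = F}"
      using True by (auto simp: H_def)
    also have "\<dots> \<in> events"
      using h edges_event[of "\<lambda>G. G = F"]
      by (intro sets.Int sets.sets_Collect_finite_All sets.sets_Collect) auto
    finally show ?thesis .
  next
    case False
    then have empty: "{x \<in> space M. H x = h \<and> E x = F} = {}"
      by (auto simp: H_def)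
    show ?thesis
      by (subst empty) simp
  qed
  have "(\<lambda>x. (H x, E x)) \<in> M \<rightarrow>\<^sub>M count_space (Pow ({1..n} \<times> {1..n}) \<times> Pow ([{1..n}]\<^bsup>2\<^esup>))"
  proof (subst measurable_count_space_eq2)
    show "finite (Pow ({1..n} \<times> {1..n}) \<times> Pow ([{1..n}]\<^bsup>2\<^esup>))"
      by (simp add: finite_imp_finite_nsets)
    show "(\<lambda>x. (H x, E x)) \<in> space M \<rightarrow> Pow ({1..n} \<times> {1..n}) \<times> Pow ([{1..n}]\<^bsup>2\<^esup>) \<and>
      (\<forall>a\<in>Pow ({1..n} \<times> {1..n}) \<times> Pow ([{1..n}]\<^bsup>2\<^esup>). (\<lambda>x. (H x, E x)) -` {a} \<inter> space M \<in> events)"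
      using measurable_space[OF edges_measurable] level
      by (fastforce simp: H_def vimage_def Int_def conj_commute)
  qed
  from measurable_compose[OF this, of "\<lambda>z. g (fst z) (snd z)" borel]
  have "(\<lambda>x. g (H x) (E x)) \<in> borel_measurable M"
    by simp
  then show ?thesis
    by (subst measurable_cong[OF g[symmetric]])
qed

end

section \<open>Events of probability tending to one\<close>

text \<open>\<open>P\<close> holds with probability tending to one. The exceptional events \<open>B n\<close> may be larger than
  necessary, so that \<open>P\<close> itself need not be measurable.\<close>

definition whp :: "(nat \<Rightarrow> 'a measure) \<Rightarrow> (nat \<Rightarrow> 'a \<Rightarrow> bool) \<Rightarrow> bool" where
  "whp M P \<longleftrightarrow> (\<exists>B. (\<forall>n. B n \<in> sets (M n)) \<and> (\<lambda>n. measure (M n) (B n)) \<longlonglongrightarrow> 0 \<and>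
     (\<forall>\<^sub>F n in sequentially. \<forall>x\<in>space (M n) - B n. P n x))"

lemma whp_conj_mono:
  assumes M: "\<And>n. prob_space (M n)" and "whp M P" "whp M Q"
    and imp: "\<forall>\<^sub>F n in sequentially. \<forall>x\<in>space (M n). P n x \<longrightarrow> Q n x \<longrightarrow> R n x"
  shows "whp M R"
proof -
  from assms(2) obtain A where A: "\<And>n. A n \<in> sets (M n)" "(\<lambda>n. measure (M n) (A n)) \<longlonglongrightarrow> 0"
      "\<forall>\<^sub>F n in sequentially. \<forall>x\<in>space (M n) - A n. P n x"
    unfolding whp_def by blast
  from assms(3) obtain B where B: "\<And>n. B n \<in> sets (M n)" "(\<lambda>n. measure (M n) (B n)) \<longlonglongrightarrow> 0"
      "\<forall>\<^sub>F n in sequentially. \<forall>x\<in>space (M n) - B n. Q n x"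
    unfolding whp_def by blast
  have "(\<lambda>n. measure (M n) (A n \<union> B n)) \<longlonglongrightarrow> 0"
  proof (rule tendsto_sandwich[OF _ _ tendsto_const])
    show "(\<lambda>n. measure (M n) (A n) + measure (M n) (B n)) \<longlonglongrightarrow> 0"
      using tendsto_add[OF A(2) B(2)] by simp
    show "\<forall>\<^sub>F n in sequentially. measure (M n) (A n \<union> B n) \<le> measure (M n) (A n) + measure (M n) (B n)"
      using A(1) B(1) by (intro always_eventually allI measure_Un_le) auto
  qed auto
  moreover have "\<forall>\<^sub>F n in sequentially. \<forall>x\<in>space (M n) - (A n \<union> B n). R n x"
    using A(3) B(3) imp by eventually_elim blast
  ultimately show ?thesis
    unfolding whp_def using A(1) B(1) by (intro exI[of _ "\<lambda>n. A n \<union> B n"]) auto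
qed

lemma whpI:
  assumes "\<forall>\<^sub>F n in sequentially. \<exists>A\<in>sets (M n). {x \<in> space (M n). \<not> P n x} \<subseteq> A \<and> measure (M n) A \<le> r n"
    and "r \<longlonglongrightarrow> (0::real)"
  shows "whp M P"
proof -
  define Q where "Q = (\<lambda>n A. {x \<in> space (M n). \<not> P n x} \<subseteq> A \<and> measure (M n) A \<le> r n)"
  define B where "B = (\<lambda>n. if \<exists>A\<in>sets (M n). Q n A then SOME A. A \<in> sets (M n) \<and> Q n A else {})"
  have B: "B n \<in> sets (M n) \<and> Q n (B n)" if "\<exists>A\<in>sets (M n). Q n A" for n
    using someI_ex[of "\<lambda>A. A \<in> sets (M n) \<and> Q n A"] that by (auto simp: B_def)
  have "B n \<in> sets (M n)" for n
    using B[of n] by (cases "\<exists>A\<in>sets (M n). Q n A") (auto simp: B_def)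
  moreover have ev: "\<forall>\<^sub>F n in sequentially. Q n (B n)"
    using assms(1) by eventually_elim (use B in \<open>auto simp: Q_def\<close>)
  then have "\<forall>\<^sub>F n in sequentially. \<forall>x\<in>space (M n) - B n. P n x"
    by eventually_elim (auto simp: Q_def)
  moreover have "(\<lambda>n. measure (M n) (B n)) \<longlonglongrightarrow> 0"
  proof (rule tendsto_sandwich[OF _ _ tendsto_const assms(2)])
    show "\<forall>\<^sub>F n in sequentially. measure (M n) (B n) \<le> r n"
      using ev by eventually_elim (simp add: Q_def)
  qed auto
  ultimately show ?thesis
    unfolding whp_def by blast
qed

lemma tendsto_in_probI:
  assumes "\<And>n. prob_space (M n)" "\<And>n. X n \<in> borel_measurable (M n)"
    and "\<And>\<epsilon>. \<epsilon> > 0 \<Longrightarrow> whp M (\<lambda>n x. \<bar>X n x - c\<bar> \<le> \<epsilon>)"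
  shows "tendsto_in_prob M X c"
  unfolding tendsto_in_prob_def
proof (intro conjI allI impI)
  fix \<epsilon> :: real assume "\<epsilon> > 0"
  from assms(3)[OF this] obtain B where B: "\<And>n. B n \<in> sets (M n)"
      "(\<lambda>n. measure (M n) (B n)) \<longlonglongrightarrow> 0"
      "\<forall>\<^sub>F n in sequentially. \<forall>x\<in>space (M n) - B n. \<bar>X n x - c\<bar> \<le> \<epsilon>"
    unfolding whp_def by blast
  show "(\<lambda>n. measure (M n) {x \<in> space (M n). \<bar>X n x - c\<bar> > \<epsilon>}) \<longlonglongrightarrow> 0"
  proof (rule tendsto_sandwich[OF _ _ tendsto_const B(2)])
    show "\<forall>\<^sub>F n in sequentially. measure (M n) {x \<in> space (M n). \<bar>X n x - c\<bar> > \<epsilon>} \<le> measure (M n) (B n)"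
      using B(3)
    proof eventually_elim
      case (elim n)
      interpret prob_space "M n"
        by (rule assms(1))
      show ?case
        using elim by (intro finite_measure_mono B(1)) force
    qed
  qed auto
qed (rule assms(2))

text \<open>The statement \<open>X n = (c + o\<^sub>p(1)) \<mu> n\<close>, phrased without division and without measurability
  of \<open>X n\<close>.\<close>

definition asymp_in_prob ::
    "(nat \<Rightarrow> 'a measure) \<Rightarrow> (nat \<Rightarrow> real) \<Rightarrow> (nat \<Rightarrow> 'a \<Rightarrow> real) \<Rightarrow> real \<Rightarrow> bool" where
  "asymp_in_prob M \<mu> X c \<longleftrightarrow> (\<forall>\<epsilon>>0. whp M (\<lambda>n x. \<bar>X n x - c * \<mu> n\<bar> \<le> \<epsilon> * \<mu> n))"

lemma asymp_in_probD:
  "asymp_in_prob M \<mu> X c \<Longrightarrow> \<epsilon> > 0 \<Longrightarrow> whp M (\<lambda>n x. \<bar>X n x - c * \<mu> n\<bar> \<le> \<epsilon> * \<mu> n)"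
  by (simp add: asymp_in_prob_def)

text \<open>The ratio is a continuous function of \<open>(X n / \<mu> n, Y n / \<mu> n)\<close> near \<open>(c, d)\<close>.\<close>

lemma tendsto_in_prob_ratio:
  assumes M: "\<And>n. prob_space (M n)" and meas: "\<And>n. (\<lambda>x. X n x / Y n x) \<in> borel_measurable (M n)"
    and X: "asymp_in_prob M \<mu> X c" and Y: "asymp_in_prob M \<mu> Y d" and d: "d \<noteq> 0"
    and \<mu>: "\<forall>\<^sub>F n in sequentially. \<mu> n > 0"
  shows "tendsto_in_prob M (\<lambda>n x. X n x / Y n x) (c / d)"
proof (rule tendsto_in_probI[OF M meas])
  fix \<epsilon> :: real assume \<epsilon>: "\<epsilon> > 0"
  have "((\<lambda>p. fst p / snd p) \<longlongrightarrow> fst (c, d) / snd (c, d)) (nhds (c, d))"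
    using d by (intro tendsto_intros filterlim_ident) auto
  then have "((\<lambda>p. fst p / snd p) \<longlongrightarrow> c / d) (nhds c \<times>\<^sub>F nhds d)"
    by (simp add: nhds_prod)
  then have "\<forall>\<^sub>F p in nhds c \<times>\<^sub>F nhds d. dist (fst p / snd p) (c / d) < \<epsilon>"
    using \<epsilon> by (rule tendstoD)
  then obtain P Q where P: "\<forall>\<^sub>F u in nhds c. P u" and Q: "\<forall>\<^sub>F v in nhds d. Q v"
      and PQ: "\<And>u v. P u \<Longrightarrow> Q v \<Longrightarrow> dist (u / v) (c / d) < \<epsilon>"
    by (auto simp: eventually_prod_filter)
  obtain \<delta>1 where \<delta>1: "\<delta>1 > 0" "\<And>u. dist u c < \<delta>1 \<Longrightarrow> P u"
    using P by (auto simp: eventually_nhds_metric)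
  obtain \<delta>2 where \<delta>2: "\<delta>2 > 0" "\<And>v. dist v d < \<delta>2 \<Longrightarrow> Q v"
    using Q by (auto simp: eventually_nhds_metric)
  show "whp M (\<lambda>n x. \<bar>X n x / Y n x - c / d\<bar> \<le> \<epsilon>)"
  proof (rule whp_conj_mono[OF M])
    show "whp M (\<lambda>n x. \<bar>X n x - c * \<mu> n\<bar> \<le> \<delta>1 / 2 * \<mu> n)"
      using \<delta>1(1) by (intro asymp_in_probD[OF X]) simp
    show "whp M (\<lambda>n x. \<bar>Y n x - d * \<mu> n\<bar> \<le> \<delta>2 / 2 * \<mu> n)"
      using \<delta>2(1) by (intro asymp_in_probD[OF Y]) simp
    have near: "dist (u / m) e < \<delta>" if "\<bar>u - e * m\<bar> \<le> \<delta> / 2 * m" "m > 0" "\<delta> > 0" for u e m \<delta> :: real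
    proof -
      have "\<bar>u / m - e\<bar> = \<bar>u - e * m\<bar> / m"
        using that(2) by (simp add: field_simps abs_if)
      also have "\<dots> \<le> \<delta> / 2"
        using that by (simp add: divide_le_eq)
      finally show ?thesis
        using that(3) by (simp add: dist_real_def)
    qed
    show "\<forall>\<^sub>F n in sequentially. \<forall>x\<in>space (M n). \<bar>X n x - c * \<mu> n\<bar> \<le> \<delta>1 / 2 * \<mu> n \<longrightarrow>
        \<bar>Y n x - d * \<mu> n\<bar> \<le> \<delta>2 / 2 * \<mu> n \<longrightarrow> \<bar>X n x / Y n x - c / d\<bar> \<le> \<epsilon>"
      using \<mu>
    proof eventually_elim
      case (elim n)
      show ?case
      proof (intro ballI impI)
        fix x assume "\<bar>X n x - c * \<mu> n\<bar> \<le> \<delta>1 / 2 * \<mu> n" "\<bar>Y n x - d * \<mu> n\<bar> \<le> \<delta>2 / 2 * \<mu> n"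
        then have "dist (X n x / \<mu> n) c < \<delta>1" "dist (Y n x / \<mu> n) d < \<delta>2"
          using near elim \<delta>1(1) \<delta>2(1) by blast+
        then have "dist ((X n x / \<mu> n) / (Y n x / \<mu> n)) (c / d) < \<epsilon>"
          using PQ \<delta>1(2) \<delta>2(2) by blast
        then show "\<bar>X n x / Y n x - c / d\<bar> \<le> \<epsilon>"
          using elim by (simp add: dist_real_def)
      qed
    qed
  qed
qed

text \<open>Upper bounds from all \<open>t\<close> below \<open>t0\<close> and lower bounds from all \<open>t\<close> above \<open>t0\<close> determine the
  asymptotics.\<close>

lemma asymp_in_prob_sandwich:
  fixes f :: "real \<Rightarrow> real"
  assumes M: "\<And>n. prob_space (M n)" and f: "isCont f t0" and t0: "0 < t0"
    and upper: "\<And>t \<epsilon>. 0 < t \<Longrightarrow> t < t0 \<Longrightarrow> 0 < \<epsilon> \<Longrightarrow> whp M (\<lambda>n x. X n x \<le> (f t + \<epsilon>) * \<mu> n)"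
    and lower: "\<And>t \<epsilon>. t0 < t \<Longrightarrow> 0 < \<epsilon> \<Longrightarrow> whp M (\<lambda>n x. (f t - \<epsilon>) * \<mu> n \<le> X n x)"
    and \<mu>: "\<forall>\<^sub>F n in sequentially. \<mu> n > 0"
  shows "asymp_in_prob M \<mu> X (f t0)"
  unfolding asymp_in_prob_def
proof (intro allI impI)
  fix \<epsilon> :: real assume \<epsilon>: "\<epsilon> > 0"
  then obtain \<delta> where \<delta>: "\<delta> > 0" "\<And>t. dist t t0 < \<delta> \<Longrightarrow> dist (f t) (f t0) < \<epsilon> / 2"
    using f unfolding continuous_at_eps_delta by (metis half_gt_zero)
  define h where "h = min (\<delta> / 2) (t0 / 2)"
  have h: "0 < h" "h < t0" "h < \<delta>"
    using \<delta>(1) t0 by (auto simp: h_def min_def)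
  have "dist (f (t0 - h)) (f t0) < \<epsilon> / 2" "dist (f (t0 + h)) (f t0) < \<epsilon> / 2"
    using \<delta>(2)[of "t0 - h"] \<delta>(2)[of "t0 + h"] h by (simp_all add: dist_real_def)
  then have near: "f (t0 - h) < f t0 + \<epsilon> / 2" "f t0 - \<epsilon> / 2 < f (t0 + h)"
    unfolding dist_real_def abs_less_iff by linarith+
  show "whp M (\<lambda>n x. \<bar>X n x - f t0 * \<mu> n\<bar> \<le> \<epsilon> * \<mu> n)"
  proof (rule whp_conj_mono[OF M])
    show "whp M (\<lambda>n x. X n x \<le> (f (t0 - h) + \<epsilon> / 2) * \<mu> n)"
      using h \<epsilon> by (intro upper) auto
    show "whp M (\<lambda>n x. (f (t0 + h) - \<epsilon> / 2) * \<mu> n \<le> X n x)"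
      using h \<epsilon> by (intro lower) auto
    show "\<forall>\<^sub>F n in sequentially. \<forall>x\<in>space (M n). X n x \<le> (f (t0 - h) + \<epsilon> / 2) * \<mu> n \<longrightarrow>
        (f (t0 + h) - \<epsilon> / 2) * \<mu> n \<le> X n x \<longrightarrow> \<bar>X n x - f t0 * \<mu> n\<bar> \<le> \<epsilon> * \<mu> n"
      using \<mu>
    proof eventually_elim
      case (elim n)
      have "(f (t0 - h) + \<epsilon> / 2) * \<mu> n \<le> (f t0 + \<epsilon>) * \<mu> n"
        "(f t0 - \<epsilon>) * \<mu> n \<le> (f (t0 + h) - \<epsilon> / 2) * \<mu> n"
        using near elim by (auto intro!: mult_right_mono)
      then show ?case
        by (auto simp: algebra_simps abs_le_iff)
    qed
  qed
qed

section \<open>Asymptotics for power-law weights\<close>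

lemma one_minus_power_choose_two_le:
  fixes q :: real
  assumes "0 \<le> q" "q \<le> 1"
  shows "(1 - q) ^ (k choose 2) \<le> exp (- q * (real k * (real k - 1) / 2))"
proof -
  have "(1 - q) ^ (k choose 2) \<le> exp (- q) ^ (k choose 2)"
    using assms exp_ge_add_one_self[of "- q"] by (intro power_mono) auto
  also have "\<dots> = exp (- q * real (k choose 2))"
    by (simp add: exp_of_nat_mult[symmetric] mult.commute)
  also have "real (k choose 2) = real k * (real k - 1) / 2"
    by (induction k) (auto simp: numeral_2_eq_2 field_simps)
  finally show ?thesis .
qed

text \<open>The left-hand side is the expected number of cliques of size \<open>k\<close> when each pair of the \<open>n\<close>
  vertices is nonadjacent with probability \<open>q\<close>, independently. It is at most the \<open>k\<close>-th power of the
  right-hand side, which is at most one.\<close>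

lemma expected_cliques_le:
  fixes q :: real
  assumes "0 \<le> q" "q \<le> 1" "1 \<le> k" and small: "real n * exp (- q * (real k - 1) / 2) \<le> 1"
  shows "real (n choose k) * (1 - q) ^ (k choose 2) \<le> real n * exp (- q * (real k - 1) / 2)"
proof -
  have "real (n choose k) \<le> real n ^ k"
    by (cases "k \<le> n") (simp_all add: binomial_le_pow binomial_eq_0 flip: of_nat_power)
  then have "real (n choose k) * (1 - q) ^ (k choose 2) \<le>
      real n ^ k * exp (- q * (real k * (real k - 1) / 2))"
    using assms by (intro mult_mono one_minus_power_choose_two_le) auto
  also have "\<dots> = (real n * exp (- q * (real k - 1) / 2)) ^ k"
    by (simp add: power_mult_distrib exp_of_nat_mult[symmetric] field_simps)
  also have "\<dots> \<le> (real n * exp (- q * (real k - 1) / 2)) ^ 1"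
    using assms by (intro power_decreasing) auto
  finally show ?thesis
    by simp
qed

text \<open>A sequence of random graphs whose common weight distribution \<open>D\<close> has a power-law tail. The
  graphs may live on different probability spaces.\<close>

locale power_law_graphs =
  fixes \<alpha> a b x0 :: real and D :: "real measure" and M :: "nat \<Rightarrow> 'a measure"
    and W :: "nat \<Rightarrow> nat \<Rightarrow> 'a \<Rightarrow> real"
    and E :: "nat \<Rightarrow> 'a \<Rightarrow> nat set set"
    and \<tau> :: "nat \<Rightarrow> 'a \<Rightarrow> nat \<Rightarrow> nat"
  assumes \<alpha>: "0 < \<alpha>" "\<alpha> < 2" and a: "0 < a" and b: "0 < b"
    and nonneg: "AE u in D. 0 \<le> u"
    and tail: "\<And>t. t \<ge> x0 \<Longrightarrow> measure D {t<..} = a * t powr (-\<alpha>)"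
    and graph: "\<And>n. weighted_random_graph (M n) n D b (W n) (E n) (\<tau> n)"
begin

lemma prob_space_M: "prob_space (M n)"
  using graph[of n] by (simp add: weighted_random_graph_def)

text \<open>The unit \<open>\<surd>(n log n)\<close> of the weights at which the cliques end. Two vertices of weight
  \<open>t * scale n\<close> are nonadjacent with probability \<open>n powr (- b t\<^sup>2)\<close>, a power of \<open>n\<close> that depends on \<open>t\<close>.\<close>

definition scale :: "nat \<Rightarrow> real" where
  "scale n = sqrt (real n * ln (real n))"

lemma scale_nonneg: "0 \<le> scale n"
  by (cases n) (simp_all add: scale_def)

text \<open>The order of the clique sizes: for large \<open>n\<close>, the expected number of vertices of weight larger
  than \<open>t * scale n\<close> is \<open>tail_const t * \<mu> n\<close>.\<close>

definition \<mu> :: "nat \<Rightarrow> real" where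
  "\<mu> n = real n powr (1 - \<alpha> / 2) * ln (real n) powr (- \<alpha> / 2)"

definition tail_const :: "real \<Rightarrow> real" where
  "tail_const t = a * t powr (-\<alpha>)"

text \<open>The number \<open>N(t)\<close> of vertices of weight larger than \<open>t * scale n\<close>.\<close>

definition num_heavy :: "real \<Rightarrow> nat \<Rightarrow> 'a \<Rightarrow> real" where
  "num_heavy t n x = real (card (heavy {1..n} (\<lambda>i. W n i x) (t * scale n)))"

lemma \<mu>_at_top: "filterlim \<mu> at_top sequentially"
  using \<alpha> unfolding \<mu>_def by real_asymp

lemma eventually_\<mu>_gt: "\<forall>\<^sub>F n in sequentially. c < \<mu> n"
  using \<mu>_at_top by (simp add: filterlim_at_top_dense)

lemma eventually_mean:
  assumes "0 < t"
  shows "\<forall>\<^sub>F n in sequentially. real n * measure D {t * scale n<..} = tail_const t * \<mu> n"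
proof -
  have "filterlim (\<lambda>n. t * scale n) at_top sequentially"
    using assms unfolding scale_def by real_asymp
  then have "\<forall>\<^sub>F n in sequentially. x0 \<le> t * scale n"
    by (simp add: filterlim_at_top)
  then show ?thesis
    using eventually_gt_at_top[of 1]
  proof eventually_elim
    case (elim n)
    have n: "0 < real n" "0 < ln (real n)"
      using elim by auto
    have "scale n powr (-\<alpha>) = (real n * ln (real n)) powr (1 / 2 * (- \<alpha>))"
      using n by (simp add: scale_def powr_half_sqrt[symmetric] powr_powr)
    also have "\<dots> = real n powr (- \<alpha> / 2) * ln (real n) powr (- \<alpha> / 2)"
      using n by (simp add: powr_mult)
    finally have "real n * scale n powr (-\<alpha>) = \<mu> n"
      using n by (simp add: \<mu>_def powr_diff powr_minus_divide)
    then show ?case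
      using assms tail[OF elim(1)] scale_nonneg[of n]
      by (simp add: tail_const_def powr_mult mult_ac)
  qed
qed

lemma eventually_nonlink_prob:
  "\<forall>\<^sub>F n in sequentially. exp (- (b * (t * scale n)\<^sup>2 / real n)) = real n powr (- (b * t\<^sup>2))"
  using eventually_gt_at_top[of 1]
proof eventually_elim
  case (elim n)
  then have "0 < real n" "0 < ln (real n)"
    by auto
  then show ?case
    by (simp add: scale_def power_mult_distrib powr_def mult_ac)
qed

lemma tail_const_pos: "0 < t \<Longrightarrow> 0 < tail_const t"
  using a by (simp add: tail_const_def)

text \<open>The number of heavy vertices is concentrated around its mean.\<close>

lemma num_heavy_asymp:
  assumes "0 < t"
  shows "asymp_in_prob M \<mu> (num_heavy t) (tail_const t)"
  unfolding asymp_in_prob_def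
proof (intro allI impI)
  fix \<epsilon> :: real assume \<epsilon>: "\<epsilon> > 0"
  show "whp M (\<lambda>n x. \<bar>num_heavy t n x - tail_const t * \<mu> n\<bar> \<le> \<epsilon> * \<mu> n)"
  proof (rule whpI)
    show "\<forall>\<^sub>F n in sequentially. \<exists>A\<in>sets (M n).
        {x \<in> space (M n). \<not> \<bar>num_heavy t n x - tail_const t * \<mu> n\<bar> \<le> \<epsilon> * \<mu> n} \<subseteq> A \<and>
        measure (M n) A \<le> tail_const t / \<epsilon>\<^sup>2 / \<mu> n"
      using eventually_mean[OF assms] eventually_\<mu>_gt[of 0]
    proof eventually_elim
      case (elim n)
      interpret weighted_random_graph "M n" n D b "W n" "E n" "\<tau> n"
        by (rule graph)
      have d: "0 < \<epsilon> * \<mu> n"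
        using \<epsilon> elim by simp
      define A where "A = {x \<in> space (M n). \<epsilon> * \<mu> n \<le> \<bar>num_heavy t n x - tail_const t * \<mu> n\<bar>}"
      have A: "A = {x \<in> space (M n). \<epsilon> * \<mu> n \<le> \<bar>real (card (heavy {1..n} (\<lambda>i. W n i x) (t * scale n))) -
          real n * measure D {t * scale n<..}\<bar>}"
        unfolding A_def num_heavy_def elim(1) ..
      have "A \<in> events"
        unfolding A by (rule prob_heavy_deviation_le(1)[OF d])
      moreover have "prob A \<le> real n * measure D {t * scale n<..} / (\<epsilon> * \<mu> n)\<^sup>2"
        unfolding A by (rule prob_heavy_deviation_le(2)[OF d])
      moreover have "real n * measure D {t * scale n<..} / (\<epsilon> * \<mu> n)\<^sup>2 = tail_const t / \<epsilon>\<^sup>2 / \<mu> n"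
        unfolding elim(1) using elim(2) by (simp add: power2_eq_square)
      moreover have "{x \<in> space (M n). \<not> \<bar>num_heavy t n x - tail_const t * \<mu> n\<bar> \<le> \<epsilon> * \<mu> n} \<subseteq> A"
        unfolding A_def not_le by (blast intro: less_imp_le)
      ultimately show ?case
        by (metis (no_types, lifting))
    qed
    show "(\<lambda>n. tail_const t / \<epsilon>\<^sup>2 / \<mu> n) \<longlonglongrightarrow> 0"
      by (intro tendsto_divide_0[OF tendsto_const] filterlim_at_top_imp_at_infinity \<mu>_at_top)
  qed
qed

text \<open>Above the threshold \<open>b t\<^sup>2 = 1 - \<alpha> / 2\<close>, only a vanishing proportion of the heavy vertices misses
  an edge to another heavy vertex.\<close>

lemma unlinked_negligible:
  assumes t: "0 < t" "1 - \<alpha> / 2 < b * t\<^sup>2" and \<epsilon>: "0 < \<epsilon>"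
  shows "whp M (\<lambda>n x. real (card (unlinked {1..n} (E n x) (\<lambda>i. W n i x) (t * scale n))) \<le> \<epsilon> * \<mu> n)"
proof (rule whpI)
  show "\<forall>\<^sub>F n in sequentially. \<exists>A\<in>sets (M n). {x \<in> space (M n).
      \<not> real (card (unlinked {1..n} (E n x) (\<lambda>i. W n i x) (t * scale n))) \<le> \<epsilon> * \<mu> n} \<subseteq> A \<and>
      measure (M n) A \<le> (tail_const t)\<^sup>2 / \<epsilon> * (\<mu> n * real n powr (- (b * t\<^sup>2)))"
    using eventually_mean[OF t(1)] eventually_nonlink_prob[of t] eventually_\<mu>_gt[of 0]
  proof eventually_elim
    case (elim n)
    interpret weighted_random_graph "M n" n D b "W n" "E n" "\<tau> n"
      by (rule graph)
    have d: "0 < \<epsilon> * \<mu> n" "0 \<le> t * scale n"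
      using \<epsilon> elim t by (auto simp: scale_nonneg)
    obtain A where A: "A \<in> events" "{x \<in> space (M n). \<epsilon> * \<mu> n \<le>
          real (card (unlinked {1..n} (E n x) (\<lambda>i. W n i x) (t * scale n)))} \<subseteq> A"
        "prob A \<le> (tail_const t * \<mu> n)\<^sup>2 * real n powr (- (b * t\<^sup>2)) / (\<epsilon> * \<mu> n)"
      using prob_unlinked_ge_le[OF less_imp_le[OF b] d(2,1)] elim by auto
    have "(tail_const t * \<mu> n)\<^sup>2 * real n powr (- (b * t\<^sup>2)) / (\<epsilon> * \<mu> n) =
        (tail_const t)\<^sup>2 / \<epsilon> * (\<mu> n * real n powr (- (b * t\<^sup>2)))"
      using elim by (simp add: power2_eq_square)
    then show ?case
      using A by (intro bexI[of _ A]) auto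
  qed
  have "(\<lambda>n. \<mu> n * real n powr (- (b * t\<^sup>2))) \<longlonglongrightarrow> 0"
  proof -
    define \<gamma> where "\<gamma> = b * t\<^sup>2"
    have "1 - \<alpha> / 2 - \<gamma> < 0"
      using t by (simp add: \<gamma>_def)
    then have "(\<lambda>n. real n powr (1 - \<alpha> / 2 - \<gamma>) * ln (real n) powr (- \<alpha> / 2)) \<longlonglongrightarrow> 0"
      by real_asymp
    then show ?thesis
      by (simp add: \<mu>_def \<gamma>_def powr_diff powr_minus_divide mult_ac)
  qed
  then show "(\<lambda>n. (tail_const t)\<^sup>2 / \<epsilon> * (\<mu> n * real n powr (- (b * t\<^sup>2)))) \<longlonglongrightarrow> 0"
    by (rule tendsto_mult_right_zero)
qed

text \<open>Above the threshold \<open>b t\<^sup>2 = 2 - \<alpha>\<close>, no edge at all is missing between heavy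
  vertices, with high probability.\<close>

lemma no_unlinked:
  assumes t: "0 < t" "2 - \<alpha> < b * t\<^sup>2"
  shows "whp M (\<lambda>n x. unlinked {1..n} (E n x) (\<lambda>i. W n i x) (t * scale n) = {})"
proof (rule whpI)
  show "\<forall>\<^sub>F n in sequentially. \<exists>A\<in>sets (M n). {x \<in> space (M n).
      \<not> unlinked {1..n} (E n x) (\<lambda>i. W n i x) (t * scale n) = {}} \<subseteq> A \<and>
      measure (M n) A \<le> (tail_const t)\<^sup>2 * ((\<mu> n)\<^sup>2 * real n powr (- (b * t\<^sup>2)))"
    using eventually_mean[OF t(1)] eventually_nonlink_prob[of t] eventually_gt_at_top[of 0]
  proof eventually_elim
    case (elim n)
    interpret weighted_random_graph "M n" n D b "W n" "E n" "\<tau> n"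
      by (rule graph)
    have d: "0 \<le> t * scale n"
      using t by (simp add: scale_nonneg)
    obtain A where A: "A \<in> events" "{x \<in> space (M n). 1 \<le>
          real (card (unlinked {1..n} (E n x) (\<lambda>i. W n i x) (t * scale n)))} \<subseteq> A"
        "prob A \<le> (tail_const t * \<mu> n)\<^sup>2 * real n powr (- (b * t\<^sup>2)) / 1"
      using prob_unlinked_ge_le[OF less_imp_le[OF b] d zero_less_one] elim by auto
    have "finite (unlinked {1..n} (E n x) (\<lambda>i. W n i x) (t * scale n))" for x
      by (simp add: unlinked_def)
    then have "1 \<le> real (card (unlinked {1..n} (E n x) (\<lambda>i. W n i x) (t * scale n)))"
      if "unlinked {1..n} (E n x) (\<lambda>i. W n i x) (t * scale n) \<noteq> {}" for x
      using that by (simp add: Suc_le_eq card_gt_0_iff)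
    then show ?case
      using A by (intro bexI[of _ A]) (auto simp: power_mult_distrib mult.assoc)
  qed
  have "(\<lambda>n. (\<mu> n)\<^sup>2 * real n powr (- (b * t\<^sup>2))) \<longlonglongrightarrow> 0"
  proof -
    define \<gamma> where "\<gamma> = b * t\<^sup>2"
    have "2 - \<alpha> - \<gamma> < 0"
      using t by (simp add: \<gamma>_def)
    then have "(\<lambda>n. (real n powr (1 - \<alpha> / 2) * ln (real n) powr (- \<alpha> / 2))\<^sup>2 * real n powr (- \<gamma>)) \<longlonglongrightarrow> 0"
      by real_asymp
    then show ?thesis
      by (simp add: \<mu>_def \<gamma>_def)
  qed
  then show "(\<lambda>n. (tail_const t)\<^sup>2 * ((\<mu> n)\<^sup>2 * real n powr (- (b * t\<^sup>2)))) \<longlonglongrightarrow> 0"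
    by (rule tendsto_mult_right_zero)
qed

text \<open>Below the first threshold, the graph on the vertices that are not heavy has edges missing so
  often that its cliques have size \<open>o(\<mu> n)\<close>.\<close>

lemma light_cliques_negligible:
  assumes t: "0 < t" "b * t\<^sup>2 < 1 - \<alpha> / 2" and \<epsilon>: "0 < \<epsilon>"
  shows "whp M (\<lambda>n x. real (clique_number {1..n} (E n x)) \<le> num_heavy t n x + \<epsilon> * \<mu> n)"
proof (rule whpI)
  define r where "r = (\<lambda>n. real n * exp (- (real n powr (- (b * t\<^sup>2)) * (\<epsilon> * \<mu> n - 2) / 2)))"
  show r: "r \<longlonglongrightarrow> 0"
  proof -
    define \<gamma> where "\<gamma> = b * t\<^sup>2"
    have \<gamma>: "1 - \<alpha> / 2 - \<gamma> > 0" "\<gamma> > 0"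
      using t b by (auto simp: \<gamma>_def)
    have "(\<lambda>n. real n * exp (- (real n powr (- \<gamma>) *
        (\<epsilon> * (real n powr (1 - \<alpha> / 2) * ln (real n) powr (- \<alpha> / 2)) - 2) / 2))) \<longlonglongrightarrow> 0"
      using \<gamma> \<epsilon> \<alpha> by real_asymp
    then show ?thesis
      by (simp add: r_def \<mu>_def \<gamma>_def)
  qed
  have "\<forall>\<^sub>F n in sequentially. r n < 1"
    using r by (rule order_tendstoD) simp
  moreover have "\<forall>\<^sub>F n in sequentially. 2 / \<epsilon> < \<mu> n"
    by (rule eventually_\<mu>_gt)
  ultimately show "\<forall>\<^sub>F n in sequentially. \<exists>A\<in>sets (M n). {x \<in> space (M n).
      \<not> real (clique_number {1..n} (E n x)) \<le> num_heavy t n x + \<epsilon> * \<mu> n} \<subseteq> A \<and> measure (M n) A \<le> r n"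
    using eventually_nonlink_prob[of t] eventually_gt_at_top[of 0]
  proof eventually_elim
    case (elim n)
    interpret weighted_random_graph "M n" n D b "W n" "E n" "\<tau> n"
      by (rule graph)
    \<comment> \<open>As \<open>b t\<^sup>2 < 1 - \<alpha> / 2\<close>, the product \<open>k * q\<close> grows like a power of \<open>n\<close>, up to logarithms.\<close>
    define k where "k = nat \<lfloor>\<epsilon> * \<mu> n\<rfloor>"
    define q where "q = real n powr (- (b * t\<^sup>2))"
    define A where "A = {x \<in> space (M n). \<exists>S\<subseteq>{1..n}. card S = k \<and> clique S (E n x) \<and>
        (\<forall>i\<in>S. W n i x \<le> t * scale n)}"
    have "2 < \<epsilon> * \<mu> n"
      using elim \<epsilon> by (simp add: field_simps)
    then have k: "1 \<le> k" "real k \<le> \<epsilon> * \<mu> n" "\<epsilon> * \<mu> n - 2 \<le> real k - 1"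
      by (simp_all add: k_def le_nat_floor) linarith+
    have q: "0 \<le> q" "q \<le> 1"
      using powr_mono[of "- (b * t\<^sup>2)" 0 "real n"] b elim by (auto simp: q_def)
    have small: "real n * exp (- q * (real k - 1) / 2) \<le> r n"
      using k(3) q elim by (auto simp: r_def q_def[symmetric] intro!: mult_left_mono)
    then have "real (n choose k) * (1 - q) ^ (k choose 2) \<le> real n * exp (- q * (real k - 1) / 2)"
      using elim k q by (intro expected_cliques_le) auto
    moreover have "prob A \<le> real (n choose k) * (1 - q) ^ (k choose 2)"
      using prob_light_clique_le(2)[OF less_imp_le[OF b] nonneg, of k "t * scale n"] elim
      by (simp add: A_def q_def)
    ultimately have "prob A \<le> r n"
      using small by linarith
    moreover have "A \<in> events"
      unfolding A_def by (rule prob_light_clique_le(1)[OF less_imp_le[OF b] nonneg])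
    moreover have "{x \<in> space (M n). \<not> real (clique_number {1..n} (E n x)) \<le>
        num_heavy t n x + \<epsilon> * \<mu> n} \<subseteq> A"
    proof
      fix x assume x: "x \<in> {x \<in> space (M n). \<not> real (clique_number {1..n} (E n x)) \<le>
        num_heavy t n x + \<epsilon> * \<mu> n}"
      show "x \<in> A"
      proof (rule ccontr)
        assume "x \<notin> A"
        then have "clique_number {1..n} (E n x) \<le> card (heavy {1..n} (\<lambda>i. W n i x) (t * scale n)) + k"
          using x by (intro clique_number_le_heavy) (auto simp: A_def not_le)
        then have "real (clique_number {1..n} (E n x)) \<le> num_heavy t n x + real k"
          by (simp add: num_heavy_def flip: of_nat_add)
        then show False
          using x k(2) by auto
      qed
    qed
    ultimately show ?case
      by blast
  qed
qed

text \<open>Below the second threshold, some edge is missing among the vertices with weights between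
  \<open>t\<close> and a slightly larger \<open>u\<close>, in units of \<open>scale n\<close>: these vertices form of the order of \<open>(\<mu> n)\<^sup>2\<close>
  pairs, and each pair is nonadjacent with conditional probability at least \<open>n powr (- b u\<^sup>2)\<close>.\<close>

lemma full_top_clique_le_num_heavy:
  assumes t: "0 < t" "b * t\<^sup>2 < 2 - \<alpha>"
  shows "whp M (\<lambda>n x. real (card (full_top_clique {1..n} (E n x) (\<lambda>i. W n i x) (\<tau> n x))) \<le> num_heavy t n x)"
proof -
  have "\<forall>\<^sub>F u in at_right t. b * u\<^sup>2 < 2 - \<alpha>"
    using t(2) by (intro order_tendstoD(2)[of "\<lambda>u. b * u\<^sup>2" "b * t\<^sup>2"] tendsto_intros)
  then have "\<forall>\<^sub>F u in at_right t. t < u \<and> b * u\<^sup>2 < 2 - \<alpha>"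
    using eventually_at_right_less[of t] by eventually_elim simp
  then obtain u where u: "t < u" "b * u\<^sup>2 < 2 - \<alpha>"
    using eventually_happens'[OF trivial_limit_at_right_real] by blast
  define \<delta> where "\<delta> = (tail_const t - tail_const u) / 2"
  have \<delta>: "0 < \<delta>"
    using t u a \<alpha> by (simp add: \<delta>_def tail_const_def powr_less_mono2_neg)
  \<comment> \<open>About \<open>2 * \<delta> * \<mu> n\<close> vertices have weights in the given range, so that \<open>k n\<close> is exceeded with
    high probability.\<close>
  define k where "k = (\<lambda>n. nat \<lfloor>\<delta> * \<mu> n\<rfloor>)"
  define S where "S = (\<lambda>n x. {i \<in> {1..n}. t * scale n < W n i x \<and> W n i x \<le> u * scale n})"
  define r where "r = (\<lambda>n. exp (- (real n powr (- (b * u\<^sup>2)) * ((\<delta> * \<mu> n - 2) * (\<delta> * \<mu> n - 2) / 2))))"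
  have r: "r \<longlonglongrightarrow> 0"
  proof -
    define \<gamma> where "\<gamma> = b * u\<^sup>2"
    have \<gamma>: "2 - \<alpha> - \<gamma> > 0" "\<gamma> > 0"
      using t u b by (auto simp: \<gamma>_def)
    have "(\<lambda>n. exp (- (real n powr (- \<gamma>) *
        ((\<delta> * (real n powr (1 - \<alpha> / 2) * ln (real n) powr (- \<alpha> / 2)) - 2) *
         (\<delta> * (real n powr (1 - \<alpha> / 2) * ln (real n) powr (- \<alpha> / 2)) - 2) / 2)))) \<longlonglongrightarrow> 0"
      using \<gamma> \<delta> \<alpha> by real_asymp
    then show ?thesis
      by (simp add: r_def \<mu>_def \<gamma>_def)
  qed
  have "whp M (\<lambda>n x. \<not> (k n \<le> card (S n x) \<and> clique (S n x) (E n x)))"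
  proof (rule whpI[OF _ r])
    show "\<forall>\<^sub>F n in sequentially. \<exists>A\<in>sets (M n). {x \<in> space (M n).
        \<not> \<not> (k n \<le> card (S n x) \<and> clique (S n x) (E n x))} \<subseteq> A \<and> measure (M n) A \<le> r n"
      using eventually_nonlink_prob[of u] eventually_gt_at_top[of 0] eventually_\<mu>_gt[of "2 / \<delta>"]
    proof eventually_elim
      case (elim n)
      interpret weighted_random_graph "M n" n D b "W n" "E n" "\<tau> n"
        by (rule graph)
      define q where "q = real n powr (- (b * u\<^sup>2))"
      define A where "A = {x \<in> space (M n). k n \<le> card (S n x) \<and> clique (S n x) (E n x)}"
      have s: "0 \<le> t * scale n"
        using t by (simp add: scale_nonneg)
      have q: "0 \<le> q" "q \<le> 1"
        using powr_mono[of "- (b * u\<^sup>2)" 0 "real n"] b elim by (auto simp: q_def)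
      have \<mu>: "2 < \<delta> * \<mu> n"
        using elim \<delta> by (simp add: field_simps)
      then have k: "\<delta> * \<mu> n - 2 \<le> real (k n) - 1"
        by (simp add: k_def) linarith
      have "prob A \<le> (1 - q) ^ (k n choose 2)"
        using prob_middle_clique_le(2)[OF less_imp_le[OF b] s, of "k n" "u * scale n"] elim
        by (simp add: A_def S_def q_def)
      also have "\<dots> \<le> exp (- q * (real (k n) * (real (k n) - 1) / 2))"
        using q by (rule one_minus_power_choose_two_le)
      also have "\<dots> \<le> exp (- q * ((\<delta> * \<mu> n - 2) * (\<delta> * \<mu> n - 2) / 2))"
      proof -
        have "(\<delta> * \<mu> n - 2) * (\<delta> * \<mu> n - 2) \<le> real (k n) * (real (k n) - 1)"
          using k \<mu> by (intro mult_mono) auto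
        then show ?thesis
          using q by (simp add: mult_left_mono)
      qed
      also have "\<dots> = r n"
        by (simp add: r_def q_def)
      finally have "prob A \<le> r n" .
      moreover have "A \<in> events"
        unfolding A_def S_def by (rule prob_middle_clique_le(1)[OF less_imp_le[OF b] s])
      ultimately show ?case
        by (intro bexI[of _ A]) (auto simp: A_def)
    qed
  qed
  moreover have "whp M (\<lambda>n x. k n \<le> card (S n x))"
  proof (rule whp_conj_mono[OF prob_space_M])
    have u0: "0 < u"
      using t u by simp
    show "whp M (\<lambda>n x. \<bar>num_heavy t n x - tail_const t * \<mu> n\<bar> \<le> \<delta> / 2 * \<mu> n)"
      using \<delta> by (intro asymp_in_probD num_heavy_asymp t) simp
    show "whp M (\<lambda>n x. \<bar>num_heavy u n x - tail_const u * \<mu> n\<bar> \<le> \<delta> / 2 * \<mu> n)"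
      using \<delta> by (intro asymp_in_probD num_heavy_asymp u0) simp
    show "\<forall>\<^sub>F n in sequentially. \<forall>x\<in>space (M n). \<bar>num_heavy t n x - tail_const t * \<mu> n\<bar> \<le> \<delta> / 2 * \<mu> n \<longrightarrow>
        \<bar>num_heavy u n x - tail_const u * \<mu> n\<bar> \<le> \<delta> / 2 * \<mu> n \<longrightarrow> k n \<le> card (S n x)"
      using eventually_gt_at_top[of 0] eventually_\<mu>_gt[of 0]
    proof eventually_elim
      case (elim n)
      show ?case
      proof (intro ballI impI)
        fix x
        assume *: "\<bar>num_heavy t n x - tail_const t * \<mu> n\<bar> \<le> \<delta> / 2 * \<mu> n"
          "\<bar>num_heavy u n x - tail_const u * \<mu> n\<bar> \<le> \<delta> / 2 * \<mu> n"
        have "t * scale n \<le> u * scale n"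
          using u by (intro mult_right_mono) (auto simp: scale_nonneg)
        from card_heavy_eq_middle[OF _ this, of "{1..n}" "\<lambda>i. W n i x"]
        have "num_heavy t n x = real (card (S n x)) + num_heavy u n x"
          by (simp add: num_heavy_def S_def)
        then have "2 * \<delta> * \<mu> n \<le> real (card (S n x)) + \<delta> * \<mu> n"
          using * unfolding abs_le_iff by (simp add: \<delta>_def field_simps)
        moreover have "real (k n) \<le> \<delta> * \<mu> n"
          using \<delta> elim by (simp add: k_def)
        ultimately show "k n \<le> card (S n x)"
          by linarith
      qed
    qed
  qed
  ultimately show ?thesis
  proof (rule whp_conj_mono[OF prob_space_M], intro always_eventually allI ballI impI)
    fix n x assume "\<not> (k n \<le> card (S n x) \<and> clique (S n x) (E n x))" "k n \<le> card (S n x)"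
    then have "card (full_top_clique {1..n} (E n x) (\<lambda>i. W n i x) (\<tau> n x)) \<le>
        card (heavy {1..n} (\<lambda>i. W n i x) (t * scale n))"
      by (intro card_full_top_clique_le_heavy[where u = "u * scale n"]) (auto simp: S_def)
    then show "real (card (full_top_clique {1..n} (E n x) (\<lambda>i. W n i x) (\<tau> n x))) \<le> num_heavy t n x"
      by (simp add: num_heavy_def)
  qed
qed

section \<open>Sizes of the cliques\<close>

lemma isCont_tail_const: "0 < t \<Longrightarrow> isCont tail_const t"
  unfolding tail_const_def by (intro continuous_intros) auto

text \<open>The weight, in units of \<open>scale n\<close>, at which the largest clique ends; the full top clique ends
  at \<open>sqrt 2 * threshold\<close>.\<close>

definition threshold :: real where
  "threshold = sqrt ((1 - \<alpha> / 2) / b)"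

lemma threshold_pos: "0 < threshold"
  using \<alpha> b by (simp add: threshold_def)

lemma threshold_square: "b * threshold\<^sup>2 = 1 - \<alpha> / 2"
  using \<alpha> b by (simp add: threshold_def)

text \<open>The upper bound needs only the clique number and the lower bound only the quasi top clique, so
  that both quantities and everything between them have the same asymptotics.\<close>

lemma asymp_between_quasi_top_and_max:
  assumes X: "\<And>n x. x \<in> space (M n) \<Longrightarrow>
      card (quasi_top_clique {1..n} (E n x) (\<lambda>i. W n i x) (\<tau> n x)) \<le> X n x \<and>
      X n x \<le> clique_number {1..n} (E n x)"
  shows "asymp_in_prob M \<mu> (\<lambda>n x. real (X n x)) (tail_const threshold)"
proof (rule asymp_in_prob_sandwich[where f = tail_const and ?t0.0 = threshold, OF prob_space_M])
  show "isCont tail_const threshold"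
    using threshold_pos by (rule isCont_tail_const)
  show "0 < threshold"
    by (rule threshold_pos)
  show "\<forall>\<^sub>F n in sequentially. 0 < \<mu> n"
    by (rule eventually_\<mu>_gt)
next
  fix t \<epsilon> :: real assume t: "0 < t" "t < threshold" and \<epsilon>: "0 < \<epsilon>"
  have t2: "b * t\<^sup>2 < 1 - \<alpha> / 2"
    using t b unfolding threshold_square[symmetric] by (simp add: power_strict_mono)
  show "whp M (\<lambda>n x. real (X n x) \<le> (tail_const t + \<epsilon>) * \<mu> n)"
  proof (rule whp_conj_mono[OF prob_space_M])
    show "whp M (\<lambda>n x. real (clique_number {1..n} (E n x)) \<le> num_heavy t n x + \<epsilon> / 2 * \<mu> n)"
      using t t2 \<epsilon> by (intro light_cliques_negligible) auto
    show "whp M (\<lambda>n x. \<bar>num_heavy t n x - tail_const t * \<mu> n\<bar> \<le> \<epsilon> / 2 * \<mu> n)"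
      using \<epsilon> by (intro asymp_in_probD num_heavy_asymp t) simp
    show "\<forall>\<^sub>F n in sequentially. \<forall>x\<in>space (M n).
        real (clique_number {1..n} (E n x)) \<le> num_heavy t n x + \<epsilon> / 2 * \<mu> n \<longrightarrow>
        \<bar>num_heavy t n x - tail_const t * \<mu> n\<bar> \<le> \<epsilon> / 2 * \<mu> n \<longrightarrow>
        real (X n x) \<le> (tail_const t + \<epsilon>) * \<mu> n"
    proof (intro always_eventually allI ballI impI)
      fix n x
      assume *: "x \<in> space (M n)"
        "real (clique_number {1..n} (E n x)) \<le> num_heavy t n x + \<epsilon> / 2 * \<mu> n"
        "\<bar>num_heavy t n x - tail_const t * \<mu> n\<bar> \<le> \<epsilon> / 2 * \<mu> n"
      have "real (X n x) \<le> real (clique_number {1..n} (E n x))"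
        using X[OF *(1)] by simp
      then show "real (X n x) \<le> (tail_const t + \<epsilon>) * \<mu> n"
        using *(2,3) unfolding abs_le_iff by (simp add: field_simps)
    qed
  qed
next
  fix t \<epsilon> :: real assume t: "threshold < t" and \<epsilon>: "0 < \<epsilon>"
  have t0: "0 < t"
    using t threshold_pos by simp
  have t2: "1 - \<alpha> / 2 < b * t\<^sup>2"
    using t b threshold_pos unfolding threshold_square[symmetric] by (simp add: power_strict_mono)
  show "whp M (\<lambda>n x. (tail_const t - \<epsilon>) * \<mu> n \<le> real (X n x))"
  proof (rule whp_conj_mono[OF prob_space_M])
    show "whp M (\<lambda>n x. real (card (unlinked {1..n} (E n x) (\<lambda>i. W n i x) (t * scale n))) \<le> \<epsilon> / 2 * \<mu> n)"
      using t0 t2 \<epsilon> by (intro unlinked_negligible) auto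
    show "whp M (\<lambda>n x. \<bar>num_heavy t n x - tail_const t * \<mu> n\<bar> \<le> \<epsilon> / 2 * \<mu> n)"
      using \<epsilon> by (intro asymp_in_probD num_heavy_asymp t0) simp
    show "\<forall>\<^sub>F n in sequentially. \<forall>x\<in>space (M n).
        real (card (unlinked {1..n} (E n x) (\<lambda>i. W n i x) (t * scale n))) \<le> \<epsilon> / 2 * \<mu> n \<longrightarrow>
        \<bar>num_heavy t n x - tail_const t * \<mu> n\<bar> \<le> \<epsilon> / 2 * \<mu> n \<longrightarrow>
        (tail_const t - \<epsilon>) * \<mu> n \<le> real (X n x)"
    proof (intro always_eventually allI ballI impI)
      fix n x
      assume *: "x \<in> space (M n)"
        "real (card (unlinked {1..n} (E n x) (\<lambda>i. W n i x) (t * scale n))) \<le> \<epsilon> / 2 * \<mu> n"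
        "\<bar>num_heavy t n x - tail_const t * \<mu> n\<bar> \<le> \<epsilon> / 2 * \<mu> n"
      have "card (heavy {1..n} (\<lambda>i. W n i x) (t * scale n)) \<le>
          X n x + card (unlinked {1..n} (E n x) (\<lambda>i. W n i x) (t * scale n))"
        using card_heavy_le_quasi_top_clique[of "{1..n}" "\<lambda>i. W n i x" "t * scale n" "E n x" "\<tau> n x"]
          X[OF *(1)] by simp
      then have "num_heavy t n x \<le>
          real (X n x) + real (card (unlinked {1..n} (E n x) (\<lambda>i. W n i x) (t * scale n)))"
        by (simp add: num_heavy_def flip: of_nat_add)
      then show "(tail_const t - \<epsilon>) * \<mu> n \<le> real (X n x)"
        using *(2,3) unfolding abs_le_iff by (simp add: field_simps)
    qed
  qed
qed

lemma full_top_clique_asymp: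
  "asymp_in_prob M \<mu> (\<lambda>n x. real (card (full_top_clique {1..n} (E n x) (\<lambda>i. W n i x) (\<tau> n x))))
     (tail_const (sqrt 2 * threshold))"
proof -
  have pos: "0 < sqrt 2 * threshold"
    using threshold_pos by simp
  have sq: "b * (sqrt 2 * threshold)\<^sup>2 = 2 - \<alpha>"
    using threshold_square by (simp add: power_mult_distrib algebra_simps)
  show ?thesis
  proof (rule asymp_in_prob_sandwich[where f = tail_const, OF prob_space_M _ pos])
    show "isCont tail_const (sqrt 2 * threshold)"
      using pos by (rule isCont_tail_const)
    show "\<forall>\<^sub>F n in sequentially. 0 < \<mu> n"
      by (rule eventually_\<mu>_gt)
  next
    fix t \<epsilon> :: real assume t: "0 < t" "t < sqrt 2 * threshold" and \<epsilon>: "0 < \<epsilon>"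
    have t2: "b * t\<^sup>2 < 2 - \<alpha>"
      unfolding sq[symmetric] using t b by (intro mult_strict_left_mono power_strict_mono) auto
    show "whp M (\<lambda>n x. real (card (full_top_clique {1..n} (E n x) (\<lambda>i. W n i x) (\<tau> n x))) \<le>
        (tail_const t + \<epsilon>) * \<mu> n)"
    proof (rule whp_conj_mono[OF prob_space_M])
      show "whp M (\<lambda>n x. \<bar>num_heavy t n x - tail_const t * \<mu> n\<bar> \<le> \<epsilon> * \<mu> n)"
        using \<epsilon> by (intro asymp_in_probD num_heavy_asymp t)
    qed (rule full_top_clique_le_num_heavy[OF t(1) t2], auto simp: algebra_simps abs_le_iff)
  next
    fix t \<epsilon> :: real assume t: "sqrt 2 * threshold < t" and \<epsilon>: "0 < \<epsilon>"
    have t0: "0 < t"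
      using t pos by linarith
    have t2: "2 - \<alpha> < b * t\<^sup>2"
      unfolding sq[symmetric] using t b pos by (intro mult_strict_left_mono power_strict_mono) auto
    show "whp M (\<lambda>n x. (tail_const t - \<epsilon>) * \<mu> n \<le>
        real (card (full_top_clique {1..n} (E n x) (\<lambda>i. W n i x) (\<tau> n x))))"
    proof (rule whp_conj_mono[OF prob_space_M])
      show "whp M (\<lambda>n x. \<bar>num_heavy t n x - tail_const t * \<mu> n\<bar> \<le> \<epsilon> * \<mu> n)"
        using \<epsilon> by (intro asymp_in_probD num_heavy_asymp t0)
      show "\<forall>\<^sub>F n in sequentially. \<forall>x\<in>space (M n).
          \<bar>num_heavy t n x - tail_const t * \<mu> n\<bar> \<le> \<epsilon> * \<mu> n \<longrightarrow>
          unlinked {1..n} (E n x) (\<lambda>i. W n i x) (t * scale n) = {} \<longrightarrow>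
          (tail_const t - \<epsilon>) * \<mu> n \<le> real (card (full_top_clique {1..n} (E n x) (\<lambda>i. W n i x) (\<tau> n x)))"
      proof (intro always_eventually allI ballI impI)
        fix n x
        assume *: "\<bar>num_heavy t n x - tail_const t * \<mu> n\<bar> \<le> \<epsilon> * \<mu> n"
          "unlinked {1..n} (E n x) (\<lambda>i. W n i x) (t * scale n) = {}"
        have "num_heavy t n x \<le> real (card (full_top_clique {1..n} (E n x) (\<lambda>i. W n i x) (\<tau> n x)))"
          using card_heavy_le_full_top_clique[OF _ *(2)] by (simp add: num_heavy_def)
        then show "(tail_const t - \<epsilon>) * \<mu> n \<le>
            real (card (full_top_clique {1..n} (E n x) (\<lambda>i. W n i x) (\<tau> n x)))"
          using *(1) by (simp add: algebra_simps abs_le_iff)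
      qed
    qed (rule no_unlinked[OF t0 t2])
  qed
qed

lemma tail_const_ratio: "tail_const (sqrt 2 * threshold) / tail_const threshold = 2 powr (-\<alpha> / 2)"
proof -
  have "sqrt 2 powr (-\<alpha>) = (2 powr (1 / 2)) powr (-\<alpha>)"
    by (subst powr_half_sqrt) auto
  also have "\<dots> = 2 powr (-\<alpha> / 2)"
    by (simp only: powr_powr) simp
  finally show ?thesis
    using threshold_pos a by (simp add: tail_const_def powr_mult)
qed

end

theorem theorem2:
  fixes \<alpha> a b x0 :: real
    and N :: "'b measure" and W :: "'b \<Rightarrow> real"
    and M :: "nat \<Rightarrow> 'a measure"
    and wt :: "nat \<Rightarrow> nat \<Rightarrow> 'a \<Rightarrow> real"
    and E :: "nat \<Rightarrow> 'a \<Rightarrow> nat set set"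
    and \<tau> :: "nat \<Rightarrow> 'a \<Rightarrow> nat \<Rightarrow> nat"
    and Kgr Kqt Kft Kmax :: "nat \<Rightarrow> 'a \<Rightarrow> nat set"
  defines "Kgr \<equiv> \<lambda>n x. greedy_clique {1..n} (E n x) (\<lambda>i. wt n i x) (\<tau> n x)"
    and "Kqt \<equiv> \<lambda>n x. quasi_top_clique {1..n} (E n x) (\<lambda>i. wt n i x) (\<tau> n x)"
    and "Kft \<equiv> \<lambda>n x. full_top_clique {1..n} (E n x) (\<lambda>i. wt n i x) (\<tau> n x)"
  assumes "0 < \<alpha>" "\<alpha> < 2" "0 < a" "0 < b" "0 < x0"
    and "prob_space N" "W \<in> borel_measurable N" "AE y in N. 0 \<le> W y"
    and "\<And>t. t \<ge> x0 \<Longrightarrow> measure N {y \<in> space N. W y > t} = a * t powr (-\<alpha>)"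
    and "\<And>n. weighted_random_graph (M n) n (distr N borel W) b (wt n) (E n) (\<tau> n)"
    and "\<And>n x. x \<in> space (M n) \<Longrightarrow> largest_clique {1..n} (E n x) (Kmax n x)"
  shows
    "(\<exists>R. tendsto_in_prob M R 0 \<and>
        (\<forall>n. \<forall>x\<in>space (M n). real (card (Kgr n x)) = (1 + R n x) * real (clique_number {1..n} (E n x))))
     \<and> (\<exists>R. tendsto_in_prob M R 0 \<and>
        (\<forall>n. \<forall>x\<in>space (M n). real (card (Kqt n x)) = (1 + R n x) * real (clique_number {1..n} (E n x))))
     \<and> tendsto_in_prob M (\<lambda>n x. real (card (Kgr n x)) / real (card (Kmax n x))) 1
     \<and> tendsto_in_prob M (\<lambda>n x. real (card (Kqt n x)) / real (card (Kmax n x))) 1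
     \<and> tendsto_in_prob M (\<lambda>n x. real (card (Kft n x)) / real (card (Kmax n x))) (2 powr (-\<alpha> / 2))"
proof -
  define D where "D = distr N borel W"
  note W_meas [measurable] = \<open>W \<in> borel_measurable N\<close>
  interpret power_law_graphs \<alpha> a b x0 D M wt E \<tau>
  proof (rule power_law_graphs.intro)
    show "AE u in D. 0 \<le> u"
      unfolding D_def using \<open>AE y in N. 0 \<le> W y\<close> by (subst AE_distr_iff) auto
    fix t assume "x0 \<le> t"
    have "W -` {t<..} \<inter> space N = {y \<in> space N. W y > t}"
      by auto
    then show "measure D {t<..} = a * t powr (-\<alpha>)"
      using assms(12)[OF \<open>x0 \<le> t\<close>] by (simp add: D_def measure_distr)
  next
    show "weighted_random_graph (M n) n D b (wt n) (E n) (\<tau> n)" for n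
      unfolding D_def by (rule assms(13))
  qed fact+
  define \<omega> where "\<omega> = (\<lambda>n x. clique_number {1..n} (E n x))"
  have Kmax: "card (Kmax n x) = \<omega> n x" if "x \<in> space (M n)" for n x
    using assms(14)[OF that] by (simp add: largest_clique_def \<omega>_def)
  have inj: "inj_on (\<tau> n x) {1..n}" if "x \<in> space (M n)" for n x
  proof -
    have "\<tau> n x permutes {1..n}"
      using measurable_space[OF weighted_random_graph.ties_measurable[OF graph] that] by simp
    then show ?thesis
      by (rule permutes_inj_on)
  qed
  have qt_le_gr: "card (Kqt n x) \<le> card (Kgr n x)" for n x
    unfolding Kqt_def Kgr_def by (rule card_quasi_top_clique_le_card_greedy_clique) simp
  have gr_le: "card (Kgr n x) \<le> \<omega> n x" if "x \<in> space (M n)" for n x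
    unfolding Kgr_def \<omega>_def using inj[OF that] by (intro card_greedy_clique_le_clique_number) auto
  have asymp: "asymp_in_prob M \<mu> (\<lambda>n x. real (X n x)) (tail_const threshold)"
    if "\<And>n x. x \<in> space (M n) \<Longrightarrow> card (Kqt n x) \<le> X n x \<and> X n x \<le> \<omega> n x" for X
    using that unfolding Kqt_def \<omega>_def by (rule asymp_between_quasi_top_and_max)
  have max: "asymp_in_prob M \<mu> (\<lambda>n x. real (\<omega> n x)) (tail_const threshold)"
    using order_trans[OF qt_le_gr gr_le] by (intro asymp) simp
  have gr: "asymp_in_prob M \<mu> (\<lambda>n x. real (card (Kgr n x))) (tail_const threshold)"
    using qt_le_gr gr_le by (intro asymp) simp
  have qt: "asymp_in_prob M \<mu> (\<lambda>n x. real (card (Kqt n x))) (tail_const threshold)"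
    using order_trans[OF qt_le_gr gr_le] by (intro asymp) simp
  have ft: "asymp_in_prob M \<mu> (\<lambda>n x. real (card (Kft n x))) (tail_const (sqrt 2 * threshold))"
    unfolding Kft_def by (rule full_top_clique_asymp)
  have nz: "tail_const threshold \<noteq> 0"
    using tail_const_pos[OF threshold_pos] by simp
  have meas: "(\<lambda>x. real (card (Kgr n x)) / real (\<omega> n x)) \<in> borel_measurable (M n)"
    "(\<lambda>x. real (card (Kqt n x)) / real (\<omega> n x)) \<in> borel_measurable (M n)"
    "(\<lambda>x. real (card (Kft n x)) / real (\<omega> n x)) \<in> borel_measurable (M n)" for n
  proof -
    have same: "Kgr n x = Kgr n y" "Kqt n x = Kqt n y" "Kft n x = Kft n y"
      if "E n x = E n y" "\<And>i j. i \<in> {1..n} \<Longrightarrow> j \<in> {1..n} \<Longrightarrow>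
        heavier (\<lambda>i. wt n i x) (\<tau> n x) j i \<longleftrightarrow> heavier (\<lambda>i. wt n i y) (\<tau> n y) j i" for x y
      using top_cliques_cong[of "{1..n}", OF that(2)] that(1)
      unfolding Kgr_def Kqt_def Kft_def by simp_all
    note measI = weighted_random_graph.measurable_order_edges[OF graph[of n]]
    show "(\<lambda>x. real (card (Kgr n x)) / real (\<omega> n x)) \<in> borel_measurable (M n)"
    proof (rule measI)
      fix x y
      assume E: "E n x = E n y" and "\<And>i j. i \<in> {1..n} \<Longrightarrow> j \<in> {1..n} \<Longrightarrow>
        heavier (\<lambda>i. wt n i x) (\<tau> n x) j i \<longleftrightarrow> heavier (\<lambda>i. wt n i y) (\<tau> n y) j i"
      from same(1)[OF this] E show "real (card (Kgr n x)) / real (\<omega> n x) = real (card (Kgr n y)) / real (\<omega> n y)"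
        by (simp add: \<omega>_def)
    qed
    show "(\<lambda>x. real (card (Kqt n x)) / real (\<omega> n x)) \<in> borel_measurable (M n)"
    proof (rule measI)
      fix x y
      assume E: "E n x = E n y" and "\<And>i j. i \<in> {1..n} \<Longrightarrow> j \<in> {1..n} \<Longrightarrow>
        heavier (\<lambda>i. wt n i x) (\<tau> n x) j i \<longleftrightarrow> heavier (\<lambda>i. wt n i y) (\<tau> n y) j i"
      from same(2)[OF this] E show "real (card (Kqt n x)) / real (\<omega> n x) = real (card (Kqt n y)) / real (\<omega> n y)"
        by (simp add: \<omega>_def)
    qed
    show "(\<lambda>x. real (card (Kft n x)) / real (\<omega> n x)) \<in> borel_measurable (M n)"
    proof (rule measI)
      fix x y
      assume E: "E n x = E n y" and "\<And>i j. i \<in> {1..n} \<Longrightarrow> j \<in> {1..n} \<Longrightarrow>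
        heavier (\<lambda>i. wt n i x) (\<tau> n x) j i \<longleftrightarrow> heavier (\<lambda>i. wt n i y) (\<tau> n y) j i"
      from same(3)[OF this] E show "real (card (Kft n x)) / real (\<omega> n x) = real (card (Kft n y)) / real (\<omega> n y)"
        by (simp add: \<omega>_def)
    qed
  qed
  have ratio: "tendsto_in_prob M (\<lambda>n x. real (card (Kgr n x)) / real (\<omega> n x)) 1"
    "tendsto_in_prob M (\<lambda>n x. real (card (Kqt n x)) / real (\<omega> n x)) 1"
    "tendsto_in_prob M (\<lambda>n x. real (card (Kft n x)) / real (\<omega> n x)) (2 powr (-\<alpha> / 2))"
    using tendsto_in_prob_ratio[OF prob_space_M meas(1) gr max nz eventually_\<mu>_gt]
      tendsto_in_prob_ratio[OF prob_space_M meas(2) qt max nz eventually_\<mu>_gt]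
      tendsto_in_prob_ratio[OF prob_space_M meas(3) ft max nz eventually_\<mu>_gt] nz
    by (simp_all only: tail_const_ratio divide_self[OF nz])
  have relative_error: "\<exists>R. tendsto_in_prob M R 0 \<and>
      (\<forall>n. \<forall>x\<in>space (M n). real (X n x) = (1 + R n x) * real (clique_number {1..n} (E n x)))"
    if X: "\<And>n x. x \<in> space (M n) \<Longrightarrow> X n x \<le> \<omega> n x"
      and lim: "tendsto_in_prob M (\<lambda>n x. real (X n x) / real (\<omega> n x)) 1" for X :: "nat \<Rightarrow> 'a \<Rightarrow> nat"
  proof (intro exI conjI allI ballI)
    have "(\<lambda>x. real (X n x) / real (\<omega> n x) - 1) \<in> borel_measurable (M n)" for n
      using lim by (intro borel_measurable_diff) (auto simp: tendsto_in_prob_def)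
    then show "tendsto_in_prob M (\<lambda>n x. real (X n x) / real (\<omega> n x) - 1) 0"
      using lim by (simp add: tendsto_in_prob_def)
    fix n x assume "x \<in> space (M n)"
    then show "real (X n x) = (1 + (real (X n x) / real (\<omega> n x) - 1)) * real (clique_number {1..n} (E n x))"
      using X[of x n] by (cases "\<omega> n x = 0") (simp_all add: \<omega>_def)
  qed
  have cong: "tendsto_in_prob M (\<lambda>n x. real (X n x) / real (card (Kmax n x))) c"
    if "tendsto_in_prob M (\<lambda>n x. real (X n x) / real (\<omega> n x)) c" for X :: "nat \<Rightarrow> 'a \<Rightarrow> nat" and c
  proof -
    have "(\<lambda>x. real (X n x) / real (card (Kmax n x))) \<in> borel_measurable (M n) \<longleftrightarrow>
        (\<lambda>x. real (X n x) / real (\<omega> n x)) \<in> borel_measurable (M n)" for n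
      by (rule measurable_cong) (simp add: Kmax)
    moreover have "{x \<in> space (M n). \<bar>real (X n x) / real (card (Kmax n x)) - c\<bar> > \<epsilon>} =
        {x \<in> space (M n). \<bar>real (X n x) / real (\<omega> n x) - c\<bar> > \<epsilon>}" for n \<epsilon>
      using Kmax by auto
    ultimately show ?thesis
      using that by (simp add: tendsto_in_prob_def)
  qed
  show ?thesis
    using relative_error[OF gr_le ratio(1)]
      relative_error[OF order_trans[OF qt_le_gr gr_le] ratio(2)] ratio[THEN cong]
    by blast
qed

end
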